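(* Let $R$ be an Artinian ring, $\Gamma$ a totally ordered group (written additively), and $FR=(F_\gamma R)_{\gamma\in\Gamma}$ a $\Gamma$-separated filtration on $R$. Then the following are equivalent: (i) the associated graded ring $G_F(R)$ is a domain; (ii) $R$ is a skewfield and $G_F(R)$ is a gr-skewfield; (iii) $R$ is a skewfield, $F_0R$ is a valuation ring of $R$ with $F_{<0}R$ as unique maximal ideal, $\Gamma_s=\{\gamma\in\Gamma: G_F(R)_\gamma\neq 0\}$ is a subgroup of $\Gamma$, and $G_F(R)$ is $\Gamma_s$-strongly graded.
   Context: Rings are associative with unit. Let $\Gamma$ be a totally ordered group (not necessarily commutative, written additively, with order compatible with the operation on both sides). A $\Gamma$-filtration $FR$ on a ring $R$ is a family of additive subgroups $F_\gamma R$ ($\gamma\in\Gamma$) with: $\gamma\le\delta$ implies $F_\gamma R\subseteq F_\delta R$; $F_\gamma R\,F_\delta R\subseteq F_{\gamma+\delta}R$; $1\in F_0R$. All filtrations are exhaustive: $\bigcup_\gamma F_\gamma R=R$. Put $F_{<\gamma}R=\sum_{\gamma'<\gamma}F_{\gamma'}R$ and $G_F(R)=\bigoplus_{\gamma\in\Gamma}F_\gamma R/F_{<\gamma}R$, a $\Gamma$-graded ring with $G_F(R)_\gamma=F_\gamma R/F_{<\gamma}R$. $FR$ is $\Gamma$-separated if for every $0\ne a\in R$ there is $\gamma\in\Gamma$ with $a\in F_\gamma R- F_{<\gamma}R$. A gr-skewfield is a (nonzero) graded ring in which every nonzero homogeneous element is invertible. A graded ring $G=\bigoplus_{\gamma\in\Gamma_s}G_\gamma$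 is $\Gamma_s$-strongly graded if $G_\gamma G_\delta=G_{\gamma+\delta}$ for all $\gamma,\delta\in\Gamma_s$. A subring $\Lambda$ of a skewfield $\Delta$ is a valuation ring of $\Delta$ if it is invariant under all inner automorphisms of $\Delta$ and for each $0\neq x\in\Delta$ either $x\in\Lambda$ or $x^{-1}\in\Lambda$. *)

theory Defs
  imports "HOL-Algebra.Algebra"
begin

section \<open>Totally ordered groups\<close>

text \<open>
  The library's ordered groups (\<open>linordered_ab_group_add\<close> and its relatives) are all abelian.
\<close>

class linordered_group_add = group_add + linorder +
  assumes group_add_left_mono: "a \<le> b \<Longrightarrow> c + a \<le> c + b"
    and group_add_right_mono: "a \<le> b \<Longrightarrow> a + c \<le> b + c"

definition add_subgroup :: "'g::group_add set \<Rightarrow> bool" where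
  "add_subgroup S \<longleftrightarrow> 0 \<in> S \<and> (\<forall>x\<in>S. \<forall>y\<in>S. x + y \<in> S) \<and> (\<forall>x\<in>S. - x \<in> S)"


section \<open>Noncommutative rings\<close>

text \<open>
  The library locales \<open>domain\<close> and \<open>field\<close> require commutativity.
\<close>

definition nc_domain :: "('a, 'm) ring_scheme \<Rightarrow> bool" where
  "nc_domain R \<longleftrightarrow> ring R \<and> \<one>\<^bsub>R\<^esub> \<noteq> \<zero>\<^bsub>R\<^esub> \<and>
     (\<forall>a\<in>carrier R. \<forall>b\<in>carrier R. a \<otimes>\<^bsub>R\<^esub> b = \<zero>\<^bsub>R\<^esub> \<longrightarrow> a = \<zero>\<^bsub>R\<^esub> \<or> b = \<zero>\<^bsub>R\<^esub>)"

definition skewfield :: "('a, 'm) ring_scheme \<Rightarrow> bool" where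
  "skewfield R \<longleftrightarrow> ring R \<and> \<one>\<^bsub>R\<^esub> \<noteq> \<zero>\<^bsub>R\<^esub> \<and> (\<forall>x\<in>carrier R - {\<zero>\<^bsub>R\<^esub>}. x \<in> Units R)"

definition left_ideal :: "'a set \<Rightarrow> ('a, 'm) ring_scheme \<Rightarrow> bool" where
  "left_ideal I R \<longleftrightarrow> additive_subgroup I R \<and> (\<forall>a\<in>I. \<forall>x\<in>carrier R. x \<otimes>\<^bsub>R\<^esub> a \<in> I)"

definition right_ideal :: "'a set \<Rightarrow> ('a, 'm) ring_scheme \<Rightarrow> bool" where
  "right_ideal I R \<longleftrightarrow> additive_subgroup I R \<and> (\<forall>a\<in>I. \<forall>x\<in>carrier R. a \<otimes>\<^bsub>R\<^esub> x \<in> I)"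

definition left_artinian :: "('a, 'm) ring_scheme \<Rightarrow> bool" where
  "left_artinian R \<longleftrightarrow>
     (\<forall>I :: nat \<Rightarrow> 'a set. (\<forall>n. left_ideal (I n) R) \<and> (\<forall>n. I (Suc n) \<subseteq> I n)
        \<longrightarrow> (\<exists>n. \<forall>m\<ge>n. I m = I n))"

definition right_artinian :: "('a, 'm) ring_scheme \<Rightarrow> bool" where
  "right_artinian R \<longleftrightarrow>
     (\<forall>I :: nat \<Rightarrow> 'a set. (\<forall>n. right_ideal (I n) R) \<and> (\<forall>n. I (Suc n) \<subseteq> I n)
        \<longrightarrow> (\<exists>n. \<forall>m\<ge>n. I m = I n))"

text \<open>
  Without a side being specified, ``Artinian'' means Artinian on both sides.
\<close>

definition artinian_ring :: "('a, 'm) ring_scheme \<Rightarrow> bool" where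
  "artinian_ring R \<longleftrightarrow> ring R \<and> left_artinian R \<and> right_artinian R"

definition valuation_ring_of :: "'a set \<Rightarrow> ('a, 'm) ring_scheme \<Rightarrow> bool" where
  "valuation_ring_of \<Lambda> \<Delta> \<longleftrightarrow> skewfield \<Delta> \<and> subring \<Lambda> \<Delta> \<and>
     (\<forall>u\<in>Units \<Delta>. (\<lambda>x. u \<otimes>\<^bsub>\<Delta>\<^esub> x \<otimes>\<^bsub>\<Delta>\<^esub> inv\<^bsub>\<Delta>\<^esub> u) ` \<Lambda> = \<Lambda>) \<and>
     (\<forall>x\<in>carrier \<Delta> - {\<zero>\<^bsub>\<Delta>\<^esub>}. x \<in> \<Lambda> \<or> inv\<^bsub>\<Delta>\<^esub> x \<in> \<Lambda>)"

definition unique_maximalideal :: "'a set \<Rightarrow> ('a, 'm) ring_scheme \<Rightarrow> bool" where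
  "unique_maximalideal M R \<longleftrightarrow> maximalideal M R \<and> (\<forall>J. maximalideal J R \<longrightarrow> J = M)"


section \<open>Graded rings\<close>

text \<open>
  \<open>graded_ring S G H\<close>: the ring \<open>G\<close> is the internal direct sum of the additive subgroups
  \<open>H \<gamma>\<close>, for \<open>\<gamma>\<close> in the subgroup \<open>S\<close> of the ambient group. The values of \<open>H\<close> outside \<open>S\<close>
  play no role.
\<close>

locale graded_ring = ring G
  for S :: "'g::group_add set" and G (structure) +
  fixes H :: "'g \<Rightarrow> 'a set"
  assumes index_subgroup: "add_subgroup S"
    and component_subgroup: "\<gamma> \<in> S \<Longrightarrow> additive_subgroup (H \<gamma>) G"
    and component_mult: "\<lbrakk>\<gamma> \<in> S; \<delta> \<in> S; x \<in> H \<gamma>; y \<in> H \<delta>\<rbrakk> \<Longrightarrow> x \<otimes> y \<in> H (\<gamma> + \<delta>)"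
    and one_component: "\<one> \<in> H 0"
    and direct_sum: "x \<in> carrier G \<Longrightarrow>
      \<exists>!f. (\<forall>\<gamma>\<in>S. f \<gamma> \<in> H \<gamma>) \<and> (\<forall>\<gamma>. \<gamma> \<notin> S \<longrightarrow> f \<gamma> = \<zero>) \<and> finite {\<gamma>. f \<gamma> \<noteq> \<zero>} \<and>
           x = (\<Oplus>\<gamma>\<in>{\<gamma>. f \<gamma> \<noteq> \<zero>}. f \<gamma>)"

definition gr_skewfield ::
    "'g::group_add set \<Rightarrow> ('a, 'm) ring_scheme \<Rightarrow> ('g \<Rightarrow> 'a set) \<Rightarrow> bool" where
  "gr_skewfield S G H \<longleftrightarrow> graded_ring S G H \<and> \<one>\<^bsub>G\<^esub> \<noteq> \<zero>\<^bsub>G\<^esub> \<and>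
     (\<forall>\<gamma>\<in>S. \<forall>x\<in>H \<gamma>. x \<noteq> \<zero>\<^bsub>G\<^esub> \<longrightarrow> x \<in> Units G)"

text \<open>
  The product of two components is the additive subgroup generated by the products of elements.
\<close>

definition strongly_graded ::
    "'g::group_add set \<Rightarrow> ('a, 'm) ring_scheme \<Rightarrow> ('g \<Rightarrow> 'a set) \<Rightarrow> bool" where
  "strongly_graded S G H \<longleftrightarrow> graded_ring S G H \<and>
     (\<forall>\<gamma>\<in>S. \<forall>\<delta>\<in>S.
        generate (add_monoid G) {x \<otimes>\<^bsub>G\<^esub> y | x y. x \<in> H \<gamma> \<and> y \<in> H \<delta>} = H (\<gamma> + \<delta>))"


section \<open>Filtrations and the associated graded ring\<close>

locale ring_filtration = ring R
  for R (structure) +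
  fixes F :: "'g::linordered_group_add \<Rightarrow> 'a set"
  assumes filtration_subgroup: "additive_subgroup (F \<gamma>) R"
    and filtration_mono: "\<gamma> \<le> \<delta> \<Longrightarrow> F \<gamma> \<subseteq> F \<delta>"
    and filtration_mult: "\<lbrakk>x \<in> F \<gamma>; y \<in> F \<delta>\<rbrakk> \<Longrightarrow> x \<otimes> y \<in> F (\<gamma> + \<delta>)"
    and filtration_one: "\<one> \<in> F 0"
    and filtration_exhaustive: "(\<Union>\<gamma>. F \<gamma>) = carrier R"

text \<open>
  \<open>filt_below R F \<gamma>\<close> is $F_{<\gamma}R$. It is the zero subgroup if nothing lies below \<open>\<gamma>\<close>, that is,
  if the group is trivial.
\<close>

definition filt_below ::
    "('a, 'm) ring_scheme \<Rightarrow> ('g::linordered_group_add \<Rightarrow> 'a set) \<Rightarrow> 'g \<Rightarrow> 'a set" where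
  "filt_below R F \<gamma> = generate (add_monoid R) (\<Union>\<gamma>'\<in>{..<\<gamma>}. F \<gamma>')"

definition separated_filtration ::
    "('a, 'm) ring_scheme \<Rightarrow> ('g::linordered_group_add \<Rightarrow> 'a set) \<Rightarrow> bool" where
  "separated_filtration R F \<longleftrightarrow>
     (\<forall>a\<in>carrier R - {\<zero>\<^bsub>R\<^esub>}. \<exists>\<gamma>. a \<in> F \<gamma> - filt_below R F \<gamma>)"

text \<open>
  The quotient $F_\gamma R / F_{<\gamma} R$; as everywhere for the library's \<open>A_Mod\<close>, the additive
  quotient group is a multiplicatively written record, whose unit is \<open>filt_below R F \<gamma>\<close>.
\<close>

definition filt_quot ::
    "('a, 'm) ring_scheme \<Rightarrow> ('g::linordered_group_add \<Rightarrow> 'a set) \<Rightarrow> 'g \<Rightarrow> 'a set monoid" where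
  "filt_quot R F \<gamma> = (R\<lparr>carrier := F \<gamma>\<rparr>) A_Mod (filt_below R F \<gamma>)"

text \<open>
  An element of $G_F(R)$ is a finitely supported family of cosets. In the product, the component of
  \<open>f g\<close> in degree \<open>\<gamma>\<close> is the sum over all \<open>\<alpha> + \<beta> = \<gamma>\<close>, so \<open>\<beta> = - \<alpha> + \<gamma>\<close>, of the products
  of \<open>f \<alpha>\<close> and \<open>g \<beta>\<close>; here $(a + F_{<\alpha}R)(b + F_{<\beta}R) = ab + F_{<\gamma}R$ is
  \<open>rcoset_mult\<close>, and the sum in $F_\gamma R / F_{<\gamma} R$ is a \<open>finprod\<close> because of the
  multiplicative notation above.
\<close>

definition assoc_gr ::
    "('a, 'm) ring_scheme \<Rightarrow> ('g::linordered_group_add \<Rightarrow> 'a set) \<Rightarrow> ('g \<Rightarrow> 'a set) ring" where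
  "assoc_gr R F =
     \<lparr>carrier = {f. (\<forall>\<gamma>. f \<gamma> \<in> carrier (filt_quot R F \<gamma>)) \<and>
                    finite {\<gamma>. f \<gamma> \<noteq> filt_below R F \<gamma>}},
      monoid.mult = (\<lambda>f g \<gamma>. finprod (filt_quot R F \<gamma>)
                    (\<lambda>\<alpha>. rcoset_mult R (filt_below R F \<gamma>) (f \<alpha>) (g (- \<alpha> + \<gamma>)))
                    {\<alpha>. f \<alpha> \<noteq> filt_below R F \<alpha>}),
      monoid.one = (\<lambda>\<gamma>. if \<gamma> = 0 then filt_below R F 0 +>\<^bsub>R\<^esub> \<one>\<^bsub>R\<^esub> else filt_below R F \<gamma>),
      ring.zero = (\<lambda>\<gamma>. filt_below R F \<gamma>),
      ring.add = (\<lambda>f g \<gamma>. f \<gamma> <+>\<^bsub>R\<^esub> g \<gamma>)\<rparr>"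

definition assoc_gr_component ::
    "('a, 'm) ring_scheme \<Rightarrow> ('g::linordered_group_add \<Rightarrow> 'a set) \<Rightarrow> 'g \<Rightarrow> ('g \<Rightarrow> 'a set) set" where
  "assoc_gr_component R F \<gamma> =
     {f \<in> carrier (assoc_gr R F). \<forall>\<delta>. \<delta> \<noteq> \<gamma> \<longrightarrow> f \<delta> = filt_below R F \<delta>}"

definition gr_support ::
    "('a, 'm) ring_scheme \<Rightarrow> ('g::linordered_group_add \<Rightarrow> 'a set) \<Rightarrow> 'g set" where
  "gr_support R F = {\<gamma>. assoc_gr_component R F \<gamma> \<noteq> {\<zero>\<^bsub>assoc_gr R F\<^esub>}}"

end

theory Submission
  imports Defs
begin

text \<open>
  For \<open>a \<noteq> 0\<close> in a separated filtered ring let the degree of \<open>a\<close> be the \<open>\<gamma>\<close> for which \<open>a\<close> lies in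
  $F_\gamma R$ but not in $F_{<\gamma} R$. The three conditions are equivalent because each of them
  says that \<open>R\<close> is a skewfield in which degrees add under multiplication (\<open>mult_degree\<close>).

  Homogeneous elements multiply in $G_F(R)$ as their representatives do in \<open>R\<close>, so zero divisors
  among them are exactly failures of additivity of the degree. A comparison of leading terms in the
  totally ordered group shows that there are no other zero divisors to consider
  (\<open>mult_degree_imp_nc_domain_Gr\<close>). If the degree is additive, \<open>R\<close> is a domain, and an Artinian
  domain is a skewfield (\<open>left_artinian_domain_imp_skewfield\<close>).

  In a skewfield with additive degree the inverse of \<open>a\<close> has the opposite degree (\<open>degree_inv\<close>),
  because \<open>1\<close> has degree \<open>0\<close>. All of (ii) and (iii) follows: nonzero homogeneous elements are
  invertible; one of \<open>x\<close> and its inverse has degree at most \<open>0\<close>; conjugation preserves the degree;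
  the units of $F_0 R$ are the elements of degree \<open>0\<close>; the degrees form a subgroup; and division by an
  element of degree \<open>\<gamma>\<close> shows that the grading is strong.

  Conversely, a homogeneous unit is not a zero divisor, which recovers additivity from (ii). From
  (iii) it is recovered by showing that the inverse of an element of degree \<open>\<alpha>\<close> lies in
  $F_{-\alpha} R$: for \<open>\<alpha> = 0\<close> because $F_{<0} R$ consists of the nonunits of the valuation ring
  $F_0 R$, and in general by strong gradedness (\<open>strongly_graded_imp_mult_degree\<close>).

  That $G_F(R)$ is a graded ring (\<open>assoc_gr_ring\<close>, \<open>assoc_gr_graded\<close>) is part of the claim; it is
  checked by computing with representatives of cosets in \<open>R\<close>.
\<close>

section \<open>Skewfields and their valuation rings\<close>

lemma (in ring) skewfieldD:
  assumes "skewfield R" "x \<in> carrier R" "x \<noteq> \<zero>"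
  shows "x \<in> Units R" "inv x \<in> carrier R" "inv x \<otimes> x = \<one>" "x \<otimes> inv x = \<one>" "inv x \<noteq> \<zero>"
proof -
  show x: "x \<in> Units R" using assms by (auto simp: skewfield_def)
  then show i: "inv x \<in> carrier R" "inv x \<otimes> x = \<one>" "x \<otimes> inv x = \<one>" by simp_all
  show "inv x \<noteq> \<zero>"
  proof
    assume "inv x = \<zero>"
    then have "\<one> = \<zero>" using i(3) assms(2) by simp
    then show False using assms(1) by (simp add: skewfield_def)
  qed
qed

lemma (in ring) skewfield_mult_one_commute:
  assumes sk: "skewfield R" and xy: "x \<in> carrier R" "y \<in> carrier R" and one: "x \<otimes> y = \<one>"
  shows "y \<otimes> x = \<one>"
proof -
  have "x \<noteq> \<zero>" using one xy(2) sk by (auto simp: skewfield_def)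
  note i = skewfieldD[OF sk xy(1) this]
  have "y = inv x \<otimes> (x \<otimes> y)" using i xy by (simp add: m_assoc[symmetric])
  then show ?thesis using one i by simp
qed

text \<open>
  A proper ideal contains no left invertible element, so it lies in any ideal \<open>M\<close> outside of which
  all elements are left invertible.
\<close>

lemma (in ring) nonunit_ideal_unique_maximal:
  assumes M: "ideal M R" and one: "\<one> \<notin> M"
    and units: "\<And>x. x \<in> carrier R - M \<Longrightarrow> \<exists>y\<in>carrier R. y \<otimes> x = \<one>"
  shows "unique_maximalideal M R"
proof -
  have sub: "J \<subseteq> M" if J: "ideal J R" "J \<noteq> carrier R" for J
  proof
    interpret J: ideal J R by fact
    fix x assume x: "x \<in> J"
    show "x \<in> M"
    proof (rule ccontr)
      assume "x \<notin> M"
      then obtain y where "y \<in> carrier R" "y \<otimes> x = \<one>" using units[of x] J.a_Hcarr[OF x] by auto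
      then have "\<one> \<in> J" using J.I_l_closed[OF x] by metis
      then show False using J.one_imp_carrier J(2) by blast
    qed
  qed
  have M_ne: "carrier R \<noteq> M" using one by auto
  have max: "maximalideal M R"
    using sub by (intro maximalidealI M M_ne) blast
  moreover have "J = M" if "maximalideal J R" for J
  proof -
    interpret J: maximalideal J R by fact
    have "M \<subseteq> carrier R" using M additive_subgroup.a_subset ideal.axioms(1) by blast
    then show ?thesis
      using J.I_maximal[OF M] sub[OF J.is_ideal] J.I_notcarr M_ne by blast
  qed
  ultimately show ?thesis unfolding unique_maximalideal_def by blast
qed

text \<open>
  The nonunits are closed under addition because of two nonzero elements one divides the other:
  a sum of nonunits \<open>x\<close> and \<open>z = x t\<close> is the multiple \<open>x (1 + t)\<close> of a nonunit.
\<close>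

lemma (in ring) valuation_ring_unique_maximalideal:
  assumes val: "valuation_ring_of A R"
  shows "unique_maximalideal {x \<in> A. \<forall>y\<in>A. y \<otimes> x \<noteq> \<one>} (R\<lparr>carrier := A\<rparr>)"
    (is "unique_maximalideal ?N ?A")
proof -
  have sk: "skewfield R" and A: "subring A R"
    and dich: "\<And>x. \<lbrakk>x \<in> carrier R; x \<noteq> \<zero>\<rbrakk> \<Longrightarrow> x \<in> A \<or> inv x \<in> A"
    using val by (auto simp: valuation_ring_of_def)
  note A_simps = subringE[OF A]
  have car: "x \<in> carrier R" if "x \<in> A" for x using that A_simps(1) by auto
  have ringA: "ring ?A" by (rule subring_is_ring[OF A])
  have l_closed: "r \<otimes> x \<in> ?N" if "r \<in> A" "x \<in> ?N" for r x
    using that A_simps car by (auto simp: m_assoc[symmetric])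
  have r_closed: "x \<otimes> r \<in> ?N" if r: "r \<in> A" and x: "x \<in> ?N" for r x
  proof -
    have "y \<otimes> (x \<otimes> r) \<noteq> \<one>" if y: "y \<in> A" for y
    proof
      assume "y \<otimes> (x \<otimes> r) = \<one>"
      then have "(y \<otimes> x) \<otimes> r = \<one>" using r x y car by (simp add: m_assoc)
      then have "r \<otimes> (y \<otimes> x) = \<one>"
        using r x y car skewfield_mult_one_commute[OF sk, of "y \<otimes> x" r] by auto
      then have "(r \<otimes> y) \<otimes> x = \<one>" using r x y car by (simp add: m_assoc)
      then show False using r x y A_simps by auto
    qed
    then show ?thesis using r x A_simps by auto
  qed
  have zero: "\<zero> \<in> ?N" using A_simps car sk by (auto simp: skewfield_def)
  have add_div: "x \<oplus> z \<in> ?N" if x: "x \<in> ?N" and t: "t \<in> A" "z = x \<otimes> t" for x z t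
  proof -
    have "x \<oplus> z = x \<otimes> (\<one> \<oplus> t)" using x t car by (simp add: r_distr)
    then show ?thesis using r_closed[OF _ x, of "\<one> \<oplus> t"] t(1) A_simps by simp
  qed
  have add_closed: "x \<oplus> z \<in> ?N" if x: "x \<in> ?N" and z: "z \<in> ?N" for x z
  proof (cases "x = \<zero> \<or> z = \<zero>")
    case True then show ?thesis using x z car by auto
  next
    case False
    have c: "x \<in> carrier R" "z \<in> carrier R" using x z car by auto
    note ix = skewfieldD[OF sk c(1)] and iz = skewfieldD[OF sk c(2)]
    let ?t = "inv x \<otimes> z"
    have z_eq: "z = x \<otimes> ?t" using ix c False by (simp add: m_assoc[symmetric])
    have t: "?t \<in> carrier R" using ix c False by simp
    have t0: "?t \<noteq> \<zero>" using z_eq c False by auto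
    have x_eq: "x = z \<otimes> inv ?t"
    proof -
      have "z \<otimes> inv ?t = x \<otimes> (?t \<otimes> inv ?t)"
        using z_eq c t skewfieldD(2)[OF sk t t0] m_assoc by metis
      then show ?thesis using skewfieldD(4)[OF sk t t0] c by simp
    qed
    from dich[OF t t0] show ?thesis
    proof
      assume "?t \<in> A" then show ?thesis using add_div[OF x _ z_eq] by simp
    next
      assume "inv ?t \<in> A" then show ?thesis using add_div[OF z _ x_eq] c by (simp add: a_comm)
    qed
  qed
  have "ideal ?N ?A"
  proof (rule idealI[OF ringA])
    have "subgroup ?N (add_monoid R)"
    proof (rule add.subgroupI)
      fix x assume x: "x \<in> ?N"
      have "(\<ominus> \<one>) \<otimes> x \<in> ?N" using x A_simps by (intro l_closed) auto
      then show "\<ominus> x \<in> ?N" using x car by (simp add: l_minus)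
    qed (use add_closed zero car in auto)
    then show "subgroup ?N (add_monoid ?A)"
      using add.subgroup_incl[OF _ subring.axioms(1)[OF A], of ?N] by auto
  qed (use l_closed r_closed in auto)
  moreover have "\<one> \<notin> ?N" using A_simps(3) car by auto
  ultimately show ?thesis
    using ring.nonunit_ideal_unique_maximal[OF ringA, of ?N] by auto
qed

section \<open>Artinian domains\<close>

text \<open>
  For \<open>x \<noteq> 0\<close> the left ideals \<open>R x\<^sup>n\<close> become constant, so \<open>x\<^sup>n = r x\<^sup>n\<^sup>+\<^sup>1\<close> for some \<open>n\<close> and \<open>r\<close>, and cancelling
  \<open>x\<^sup>n\<close> leaves \<open>r x = 1\<close>. The left inverse \<open>r\<close> has a left inverse in its turn, which can only be
  \<open>x\<close>, so \<open>r\<close> is inverse to \<open>x\<close> on both sides.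
\<close>

lemma left_artinian_domain_imp_skewfield:
  fixes R (structure)
  assumes "nc_domain R" and art: "left_artinian R"
  shows "skewfield R"
proof -
  from assms(1) interpret ring R by (simp add: nc_domain_def)
  have nz: "\<one> \<noteq> \<zero>"
    and dom: "\<And>a b. \<lbrakk>a \<in> carrier R; b \<in> carrier R; a \<otimes> b = \<zero>\<rbrakk> \<Longrightarrow> a = \<zero> \<or> b = \<zero>"
    using assms(1) by (auto simp: nc_domain_def)
  have left_inv: "\<exists>r\<in>carrier R. r \<otimes> x = \<one>" if x: "x \<in> carrier R" "x \<noteq> \<zero>" for x
  proof -
    define I where "I n = (\<lambda>r. r \<otimes> x [^] (n::nat)) ` carrier R" for n
    have pow: "x [^] n \<in> carrier R" for n :: nat using x by simp
    have pow_nz: "x [^] n \<noteq> \<zero>" for n :: nat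
    proof (induction n)
      case (Suc n) then show ?case using dom[of "x [^] n" x] x pow by auto
    qed (use nz in simp)
    have ideals: "left_ideal (I n) R" for n
      unfolding left_ideal_def
    proof (intro conjI additive_subgroupI ballI)
      show "subgroup (I n) (add_monoid R)"
      proof (rule add.subgroupI)
        show "I n \<subseteq> carrier R" "I n \<noteq> {}" using pow by (auto simp: I_def)
        fix a b assume ab: "a \<in> I n" "b \<in> I n"
        then obtain r s where "r \<in> carrier R" "a = r \<otimes> x [^] n" "s \<in> carrier R" "b = s \<otimes> x [^] n"
          by (auto simp: I_def)
        then have "\<ominus> a = (\<ominus> r) \<otimes> x [^] n" "a \<oplus> b = (r \<oplus> s) \<otimes> x [^] n"
          "\<ominus> r \<in> carrier R" "r \<oplus> s \<in> carrier R"
          using pow by (simp_all add: l_minus l_distr)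
        then show "\<ominus> a \<in> I n" "a \<oplus> b \<in> I n" unfolding I_def by blast+
      qed
      fix a y assume "a \<in> I n" "y \<in> carrier R"
      then show "y \<otimes> a \<in> I n"
        unfolding I_def using pow by (auto simp: m_assoc[symmetric])
    qed
    have decreasing: "I (Suc n) \<subseteq> I n" for n
    proof
      fix a assume "a \<in> I (Suc n)"
      then obtain r where r: "r \<in> carrier R" "a = r \<otimes> x [^] (Suc n)"
        unfolding I_def by blast
      then have "a = (r \<otimes> x) \<otimes> x [^] n"
        using x pow by (simp only: m_assoc nat_pow_Suc2)
      then show "a \<in> I n" using r x by (auto simp: I_def)
    qed
    have "(\<forall>n. left_ideal (I n) R) \<and> (\<forall>n. I (Suc n) \<subseteq> I n)"
      using ideals decreasing by simp
    with art[unfolded left_artinian_def, rule_format, of I]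
    obtain n where "\<forall>m\<ge>n. I m = I n" by blast
    then have "I (Suc n) = I n" using le_SucI[OF order_refl] by blast
    moreover have "x [^] n \<in> I n" unfolding I_def using pow by (auto intro!: image_eqI[of _ _ \<one>])
    ultimately obtain r where r: "r \<in> carrier R" "x [^] n = r \<otimes> (x \<otimes> x [^] n)"
      unfolding I_def nat_pow_Suc2[OF x(1)] by blast
    have "(\<one> \<ominus> r \<otimes> x) \<otimes> x [^] n = x [^] n \<ominus> r \<otimes> (x \<otimes> x [^] n)"
      using r(1) x pow by (simp add: minus_eq l_distr l_minus m_assoc)
    also have "\<dots> = \<zero>" using pow by (simp add: r(2)[symmetric] r_neg minus_eq)
    finally have "\<one> \<ominus> r \<otimes> x = \<zero>"
      using dom[of "\<one> \<ominus> r \<otimes> x" "x [^] n"] pow_nz pow r(1) x by auto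
    then show ?thesis using r(1) x by (intro bexI[of _ r]) auto
  qed
  show ?thesis
    unfolding skewfield_def
  proof (intro conjI ballI ring_axioms nz)
    fix x assume "x \<in> carrier R - {\<zero>}"
    then have x: "x \<in> carrier R" "x \<noteq> \<zero>" by auto
    obtain r where r: "r \<in> carrier R" "r \<otimes> x = \<one>" using left_inv[OF x] by auto
    then have "r \<noteq> \<zero>" using x nz by auto
    then obtain s where s: "s \<in> carrier R" "s \<otimes> r = \<one>" using left_inv[OF r(1)] by auto
    have "s = s \<otimes> (r \<otimes> x)" using r s by simp
    also have "\<dots> = x" using r(1) s x by (simp add: m_assoc[symmetric])
    finally have "x \<otimes> r = \<one>" using s by simp
    with r x show "x \<in> Units R" by (auto simp: Units_def)
  qed
qed

section \<open>Ordered groups and iterated sums\<close>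

lemma group_add_strict_left_mono:
  "a < b \<Longrightarrow> c + a < c + b" for a b c :: "'g::linordered_group_add"
  using group_add_left_mono[of a b c] by (auto simp: less_le)

lemma group_add_strict_right_mono:
  "a < b \<Longrightarrow> a + c < b + c" for a b c :: "'g::linordered_group_add"
  using group_add_right_mono[of a b c] by (auto simp: less_le)

lemma minus_sum: "- (\<alpha> + \<beta>) + \<gamma> = - \<beta> + (- \<alpha> + \<gamma>)" for \<alpha> \<beta> \<gamma> :: "'g::group_add"
  by (simp add: group_add_class.minus_add Groups.add.assoc del: add_uminus_conv_diff)

lemma (in abelian_monoid) finsum_swap:
  assumes "finite A" "finite B" "\<And>i j. i \<in> A \<Longrightarrow> j \<in> B \<Longrightarrow> h i j \<in> carrier G"
  shows "(\<Oplus>i\<in>A. \<Oplus>j\<in>B. h i j) = (\<Oplus>j\<in>B. \<Oplus>i\<in>A. h i j)"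
  using assms(1,3)
proof (induction A rule: finite_induct)
  case (insert k A)
  then have "(\<Oplus>i\<in>insert k A. \<Oplus>j\<in>B. h i j) = (\<Oplus>j\<in>B. h k j) \<oplus> (\<Oplus>j\<in>B. \<Oplus>i\<in>A. h i j)"
    by (subst finsum_insert) (auto intro!: finsum_closed)
  also have "\<dots> = (\<Oplus>j\<in>B. h k j \<oplus> (\<Oplus>i\<in>A. h i j))"
    using insert by (intro finsum_addf[symmetric]) (auto intro!: finsum_closed)
  also have "\<dots> = (\<Oplus>j\<in>B. \<Oplus>i\<in>insert k A. h i j)"
    using insert by (intro finsum_cong') (auto intro!: finsum_closed)
  finally show ?case .
qed simp

section \<open>The lower filtration steps and their cosets\<close>

context ring_filtration
begin

abbreviation below :: "'g \<Rightarrow> 'a set" where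
  "below \<equiv> filt_below R F"

abbreviation Gr :: "('g \<Rightarrow> 'a set) ring" where
  "Gr \<equiv> assoc_gr R F"

abbreviation Gr_comp :: "'g \<Rightarrow> ('g \<Rightarrow> 'a set) set" where
  "Gr_comp \<equiv> assoc_gr_component R F"

interpretation Fsub: additive_subgroup "F \<gamma>" R for \<gamma>
  by (rule filtration_subgroup)

lemma F_carrier [dest]: "x \<in> F \<gamma> \<Longrightarrow> x \<in> carrier R"
  using Fsub.a_subset by auto

text \<open>
  The steps below \<open>\<gamma>\<close> form a chain, so their union is already closed under addition. The
  disjunct \<open>x = \<zero>\<close> matters only if \<open>\<Gamma>\<close> is trivial and the union is empty.
\<close>

lemma below_iff: "x \<in> below \<gamma> \<longleftrightarrow> x = \<zero> \<or> (\<exists>\<delta><\<gamma>. x \<in> F \<delta>)"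
proof
  let ?U = "{\<zero>} \<union> (\<Union>\<delta>\<in>{..<\<gamma>}. F \<delta>)"
  have "subgroup ?U (add_monoid R)"
  proof (rule add.subgroupI)
    fix x y assume "x \<in> ?U" "y \<in> ?U"
    then consider "x = \<zero>" | "y = \<zero>"
      | \<alpha> \<beta> where "\<alpha> < \<gamma>" "x \<in> F \<alpha>" "\<beta> < \<gamma>" "y \<in> F \<beta>" by auto
    then show "x \<oplus> y \<in> ?U"
    proof cases
      case 3
      then have "x \<in> F (max \<alpha> \<beta>)" "y \<in> F (max \<alpha> \<beta>)" "max \<alpha> \<beta> < \<gamma>"
        using filtration_mono[of \<alpha> "max \<alpha> \<beta>"] filtration_mono[of \<beta> "max \<alpha> \<beta>"] by auto
      then show ?thesis by blast
    qed (use \<open>x \<in> ?U\<close> \<open>y \<in> ?U\<close> in auto)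
  qed auto
  then have "below \<gamma> \<subseteq> ?U"
    unfolding filt_below_def by (intro add.generate_subgroup_incl) auto
  then show "x \<in> below \<gamma> \<Longrightarrow> x = \<zero> \<or> (\<exists>\<delta><\<gamma>. x \<in> F \<delta>)" by auto
  show "x = \<zero> \<or> (\<exists>\<delta><\<gamma>. x \<in> F \<delta>) \<Longrightarrow> x \<in> below \<gamma>"
    unfolding filt_below_def using generate.one[of "add_monoid R"] by (auto intro: generate.incl)
qed

lemma below_subset: "below \<gamma> \<subseteq> F \<gamma>"
  by (auto simp: below_iff intro: subsetD[OF filtration_mono[OF less_imp_le]])

lemma below_abelian_subgroup: "abelian_subgroup (below \<gamma>) R"
proof -
  have "(\<Union>\<delta>\<in>{..<\<gamma>}. F \<delta>) \<subseteq> carrier R" by auto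
  then have "additive_subgroup (below \<gamma>) R"
    unfolding filt_below_def by (intro additive_subgroupI add.generate_is_subgroup)
  then show ?thesis by (rule abelian_subgroupI3[OF _ is_abelian_group])
qed

interpretation Bsub: abelian_subgroup "below \<gamma>" R for \<gamma>
  by (rule below_abelian_subgroup)

lemma F_mult_below:
  assumes "x \<in> F \<alpha>" "y \<in> below \<beta>" shows "x \<otimes> y \<in> below (\<alpha> + \<beta>)"
proof (cases "y = \<zero>")
  case True then show ?thesis using assms by auto
next
  case False
  then obtain \<delta> where "\<delta> < \<beta>" "y \<in> F \<delta>" using assms by (auto simp: below_iff)
  then show ?thesis
    using assms(1) filtration_mult group_add_strict_left_mono unfolding below_iff by blast
qed

lemma below_mult_F:
  assumes "x \<in> below \<alpha>" "y \<in> F \<beta>" shows "x \<otimes> y \<in> below (\<alpha> + \<beta>)"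
proof (cases "x = \<zero>")
  case True then show ?thesis using assms by auto
next
  case False
  then obtain \<delta> where "\<delta> < \<alpha>" "x \<in> F \<delta>" using assms by (auto simp: below_iff)
  then show ?thesis
    using assms(2) filtration_mult group_add_strict_right_mono unfolding below_iff by blast
qed

lemma coset_eq_iff:
  assumes "x \<in> carrier R" "y \<in> carrier R"
  shows "below \<gamma> +> x = below \<gamma> +> y \<longleftrightarrow> x \<ominus> y \<in> below \<gamma>"
proof -
  have "below \<gamma> +> x = below \<gamma> +> y \<longleftrightarrow> x \<in> below \<gamma> +> y"
    using assms Bsub.a_rcos_self Bsub.a_repr_independence' by metis
  also have "\<dots> \<longleftrightarrow> x \<ominus> y \<in> below \<gamma>"
    using assms Bsub.a_rcos_module_minus[OF ring_axioms] by blast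
  finally show ?thesis .
qed

lemma coset_zero [simp]: "below \<gamma> +> \<zero> = below \<gamma>"
  using Bsub.a_subset by (rule a_coset_add_zero)

lemma coset_trivial_iff:
  assumes "x \<in> carrier R" shows "below \<gamma> +> x = below \<gamma> \<longleftrightarrow> x \<in> below \<gamma>"
  using coset_eq_iff[OF assms zero_closed] assms by (simp add: minus_eq)

text \<open>
  Multiplication of cosets of different filtration steps is well defined: changing a factor by an
  element of lower degree changes the product by an element of lower degree.
\<close>

lemma rcoset_mult_coset:
  assumes x: "x \<in> F \<alpha>" and y: "y \<in> F \<beta>" and \<gamma>: "\<gamma> = \<alpha> + \<beta>"
  shows "rcoset_mult R (below \<gamma>) (below \<alpha> +> x) (below \<beta> +> y) = below \<gamma> +> (x \<otimes> y)"
proof -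
  have eq: "below \<gamma> +> ((h \<oplus> x) \<otimes> (k \<oplus> y)) = below \<gamma> +> (x \<otimes> y)"
    if "h \<in> below \<alpha>" "k \<in> below \<beta>" for h k
  proof -
    have c: "x \<in> carrier R" "y \<in> carrier R" "h \<in> carrier R" "k \<in> carrier R"
      using x y that by auto
    have "(h \<oplus> x) \<otimes> (k \<oplus> y) \<ominus> x \<otimes> y = h \<otimes> k \<oplus> h \<otimes> y \<oplus> x \<otimes> k"
      using c by algebra
    moreover have "h \<otimes> k \<in> below \<gamma>" "h \<otimes> y \<in> below \<gamma>" "x \<otimes> k \<in> below \<gamma>"
      unfolding \<gamma> using that x y below_subset by (auto intro: below_mult_F F_mult_below)
    ultimately show ?thesis using c by (subst coset_eq_iff) auto
  qed
  have "below \<gamma> +> (a \<otimes> b) = below \<gamma> +> (x \<otimes> y)"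
    if ab: "a \<in> below \<alpha> +> x" "b \<in> below \<beta> +> y" for a b
  proof -
    obtain h k where "h \<in> below \<alpha>" "k \<in> below \<beta>" "a = h \<oplus> x" "b = k \<oplus> y"
      using ab by (auto simp: a_r_coset_def')
    then show ?thesis using eq by simp
  qed
  then have "(\<Union>a\<in>below \<alpha> +> x. \<Union>b\<in>below \<beta> +> y. below \<gamma> +> (a \<otimes> b)) =
    (\<Union>a\<in>below \<alpha> +> x. \<Union>b\<in>below \<beta> +> y. below \<gamma> +> (x \<otimes> y))" by (intro SUP_cong refl)
  moreover have "below \<alpha> +> x \<noteq> {}" "below \<beta> +> y \<noteq> {}"
    using x y Bsub.a_rcos_self by (blast dest: F_carrier)+
  ultimately show ?thesis unfolding rcoset_mult_def by simp
qed

lemma filt_quot_carrier: "carrier (filt_quot R F \<gamma>) = (\<lambda>x. below \<gamma> +> x) ` F \<gamma>"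
  by (simp add: filt_quot_def A_FactGroup_defs RCOSETS_def a_r_coset_def r_coset_def
      UNION_singleton_eq_range)

lemma filt_quot_simps [simp]:
  "monoid.mult (filt_quot R F \<gamma>) = set_add R"
  "monoid.one (filt_quot R F \<gamma>) = below \<gamma>"
  by (simp_all add: filt_quot_def A_FactGroup_defs set_add_defs fun_eq_iff)

lemma coset_add [simp]:
  assumes "x \<in> carrier R" "y \<in> carrier R"
  shows "set_add R (below \<gamma> +> x) (below \<gamma> +> y) = below \<gamma> +> (x \<oplus> y)"
  using assms by (rule Bsub.a_rcos_sum)

lemma coset_add_below [simp]:
  assumes "x \<in> carrier R"
  shows "set_add R (below \<gamma>) (below \<gamma> +> x) = below \<gamma> +> x"
    and "set_add R (below \<gamma> +> x) (below \<gamma>) = below \<gamma> +> x"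
  using coset_add[OF zero_closed assms] coset_add[OF assms zero_closed] assms by simp_all

lemma filt_quot_comm_monoid: "comm_monoid (filt_quot R F \<gamma>)"
proof (rule comm_monoidI)
  show "\<one>\<^bsub>filt_quot R F \<gamma>\<^esub> \<in> carrier (filt_quot R F \<gamma>)"
    by (auto simp: filt_quot_carrier intro!: image_eqI[of _ _ \<zero>])
qed (auto simp: filt_quot_carrier a_ac F_carrier)

lemma finsum_in_F:
  assumes "finite T" "\<And>i. i \<in> T \<Longrightarrow> h i \<in> F \<gamma>"
  shows "(\<Oplus>i\<in>T. h i) \<in> F \<gamma>"
  using assms
proof (induction T rule: finite_induct)
  case (insert j T)
  then have "(\<Oplus>i\<in>insert j T. h i) = h j \<oplus> (\<Oplus>i\<in>T. h i)" by (subst finsum_insert) auto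
  then show ?case using insert by simp
qed simp

text \<open>
  The sum of cosets in the product of the associated graded ring can thus be computed on
  representatives in \<open>R\<close>.
\<close>

lemma finprod_coset:
  assumes "finite T" "\<And>i. i \<in> T \<Longrightarrow> h i \<in> F \<gamma>"
  shows "finprod (filt_quot R F \<gamma>) (\<lambda>i. below \<gamma> +> h i) T = below \<gamma> +> (\<Oplus>i\<in>T. h i)"
    (is "?lhs T = ?rhs T")
proof -
  interpret Q: comm_monoid "filt_quot R F \<gamma>" by (rule filt_quot_comm_monoid)
  show ?thesis
    using assms
  proof (induction T rule: finite_induct)
    case (insert j T)
    then have "?lhs (insert j T) = set_add R (below \<gamma> +> h j) (?lhs T)"
      by (subst Q.finprod_insert) (auto simp: filt_quot_carrier)
    moreover have "(\<Oplus>i\<in>insert j T. h i) = h j \<oplus> (\<Oplus>i\<in>T. h i)"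
      using insert by (subst finsum_insert) auto
    moreover have "h j \<in> carrier R" "(\<Oplus>i\<in>T. h i) \<in> carrier R"
      using insert by (auto intro!: finsum_closed)
    ultimately show ?case using insert by simp
  qed (simp add: Q.finprod_empty)
qed

section \<open>The associated graded ring is a ring\<close>

text \<open>
  The ring axioms are verified on representatives. A finitely supported family \<open>a\<close> with
  \<open>a \<gamma> \<in> F \<gamma>\<close> represents the element \<open>symbol a\<close> of the associated graded ring, and the
  operations of this ring are induced by addition and convolution of families, for which the
  axioms hold already in \<open>R\<close>.
\<close>

definition fam :: "('g \<Rightarrow> 'a) set" where
  "fam = {a. (\<forall>\<gamma>. a \<gamma> \<in> F \<gamma>) \<and> finite {\<gamma>. a \<gamma> \<noteq> \<zero>}}"

definition symbol :: "('g \<Rightarrow> 'a) \<Rightarrow> 'g \<Rightarrow> 'a set" where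
  "symbol a = (\<lambda>\<gamma>. below \<gamma> +> a \<gamma>)"

definition conv :: "('g \<Rightarrow> 'a) \<Rightarrow> ('g \<Rightarrow> 'a) \<Rightarrow> 'g \<Rightarrow> 'a" where
  "conv a b = (\<lambda>\<gamma>. \<Oplus>\<alpha>\<in>{\<alpha>. a \<alpha> \<noteq> \<zero>}. a \<alpha> \<otimes> b (- \<alpha> + \<gamma>))"

definition single :: "'g \<Rightarrow> 'a \<Rightarrow> 'g \<Rightarrow> 'a" where
  "single \<alpha> x = (\<lambda>\<gamma>. if \<gamma> = \<alpha> then x else \<zero>)"

lemma famD:
  assumes "a \<in> fam"
  shows "a \<gamma> \<in> F \<gamma>" "a \<gamma> \<in> carrier R" "finite {\<gamma>. a \<gamma> \<noteq> \<zero>}"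
  using assms by (auto simp: fam_def)

lemma single_fam: "x \<in> F \<alpha> \<Longrightarrow> single \<alpha> x \<in> fam"
  by (auto simp: fam_def single_def intro: finite_subset[of _ "{\<alpha>}"])

lemma zero_fam: "(\<lambda>_. \<zero>) \<in> fam"
  by (simp add: fam_def)

lemma add_fam:
  assumes "a \<in> fam" "b \<in> fam" shows "(\<lambda>\<gamma>. a \<gamma> \<oplus> b \<gamma>) \<in> fam"
proof -
  have "{\<gamma>. a \<gamma> \<oplus> b \<gamma> \<noteq> \<zero>} \<subseteq> {\<gamma>. a \<gamma> \<noteq> \<zero>} \<union> {\<gamma>. b \<gamma> \<noteq> \<zero>}" by auto
  then show ?thesis using assms finite_subset by (fastforce simp: fam_def)
qed

lemma neg_fam:
  assumes "a \<in> fam" shows "(\<lambda>\<gamma>. \<ominus> a \<gamma>) \<in> fam"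
proof -
  have "{\<gamma>. \<ominus> a \<gamma> \<noteq> \<zero>} \<subseteq> {\<gamma>. a \<gamma> \<noteq> \<zero>}" by auto
  then show ?thesis using assms finite_subset by (fastforce simp: fam_def)
qed

lemma conv_term:
  assumes "a \<in> fam" "b \<in> fam" shows "a \<alpha> \<otimes> b (- \<alpha> + \<gamma>) \<in> F \<gamma>"
  using filtration_mult[of "a \<alpha>" \<alpha> "b (- \<alpha> + \<gamma>)" "- \<alpha> + \<gamma>"] assms famD by simp

text \<open>
  The set of indices can be enlarged at will; this makes convolutions with different supports
  comparable.
\<close>

lemma conv_eq:
  assumes "a \<in> fam" "b \<in> fam" "finite A" "{\<alpha>. a \<alpha> \<noteq> \<zero>} \<subseteq> A"
  shows "conv a b \<gamma> = (\<Oplus>\<alpha>\<in>A. a \<alpha> \<otimes> b (- \<alpha> + \<gamma>))"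
  unfolding conv_def using assms famD[of a] famD[of b]
  by (intro add.finprod_mono_neutral_cong_left) auto

lemma conv_fam:
  assumes a: "a \<in> fam" and b: "b \<in> fam" shows "conv a b \<in> fam"
proof -
  have supp: "\<gamma> \<in> (\<lambda>(\<alpha>, \<beta>). \<alpha> + \<beta>) ` ({\<alpha>. a \<alpha> \<noteq> \<zero>} \<times> {\<beta>. b \<beta> \<noteq> \<zero>})"
    if nz: "conv a b \<gamma> \<noteq> \<zero>" for \<gamma>
  proof (rule ccontr)
    assume nex: "\<not> ?thesis"
    have "a \<alpha> \<otimes> b (- \<alpha> + \<gamma>) = \<zero>" if "a \<alpha> \<noteq> \<zero>" for \<alpha>
    proof -
      have "\<gamma> = \<alpha> + (- \<alpha> + \<gamma>)" by simp
      then have "b (- \<alpha> + \<gamma>) = \<zero>" using nex that by force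
      then show ?thesis using famD[OF a] by simp
    qed
    then have "conv a b \<gamma> = (\<Oplus>\<alpha>\<in>{\<alpha>. a \<alpha> \<noteq> \<zero>}. \<zero>)"
      unfolding conv_def by (intro finsum_cong') auto
    then show False using nz by simp
  qed
  have "conv a b \<gamma> \<in> F \<gamma>" for \<gamma>
    unfolding conv_def using a b by (intro finsum_in_F conv_term famD)
  moreover have "finite {\<gamma>. conv a b \<gamma> \<noteq> \<zero>}"
  proof (rule finite_subset)
    show "{\<gamma>. conv a b \<gamma> \<noteq> \<zero>} \<subseteq> (\<lambda>(\<alpha>, \<beta>). \<alpha> + \<beta>) ` ({\<alpha>. a \<alpha> \<noteq> \<zero>} \<times> {\<beta>. b \<beta> \<noteq> \<zero>})"
      using supp by blast
    show "finite \<dots>" using famD(3)[OF a] famD(3)[OF b] by simp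
  qed
  ultimately show ?thesis by (simp add: fam_def)
qed

text \<open>
  Both sides at \<open>\<gamma>\<close> are the sum of \<open>a \<alpha> b \<beta> c \<epsilon>\<close> over \<open>\<alpha> + \<beta> + \<epsilon> = \<gamma>\<close>: after interchanging
  the sums, the substitution \<open>\<delta> = \<alpha> + \<beta>\<close> turns the inner one into the convolution of \<open>b\<close> and \<open>c\<close>.
\<close>

lemma conv_assoc:
  assumes a: "a \<in> fam" and b: "b \<in> fam" and c: "c \<in> fam"
  shows "conv (conv a b) c = conv a (conv b c)"
proof
  fix \<gamma>
  define A where "A = {\<alpha>. a \<alpha> \<noteq> \<zero>}"
  define B where "B = {\<beta>. b \<beta> \<noteq> \<zero>}"
  \<comment> \<open>large enough that \<open>- \<alpha> + D\<close> contains the support of \<open>b\<close> for every \<open>\<alpha> \<in> A\<close>\<close>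
  define D where "D = {\<delta>. conv a b \<delta> \<noteq> \<zero>} \<union> (\<lambda>(\<alpha>, \<beta>). \<alpha> + \<beta>) ` (A \<times> B)"
  have fin: "finite A" "finite B" "finite D"
    using famD(3)[OF a] famD(3)[OF b] famD(3)[OF conv_fam[OF a b]] by (auto simp: A_def B_def D_def)
  note car = famD(2)[OF a] famD(2)[OF b] famD(2)[OF c] famD(2)[OF conv_fam[OF b c]]
  have inner: "(\<Oplus>\<delta>\<in>D. b (- \<alpha> + \<delta>) \<otimes> c (- \<delta> + \<gamma>)) = conv b c (- \<alpha> + \<gamma>)"
    if "\<alpha> \<in> A" for \<alpha>
  proof -
    have D: "D = (+) \<alpha> ` (+) (- \<alpha>) ` D" by (simp add: image_image)
    have "(\<Oplus>\<delta>\<in>D. b (- \<alpha> + \<delta>) \<otimes> c (- \<delta> + \<gamma>)) =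
        (\<Oplus>\<epsilon>\<in>(+) (- \<alpha>) ` D. b (- \<alpha> + (\<alpha> + \<epsilon>)) \<otimes> c (- (\<alpha> + \<epsilon>) + \<gamma>))"
      by (subst (1) D, subst finsum_reindex) (use car in auto)
    also have "\<dots> = (\<Oplus>\<epsilon>\<in>(+) (- \<alpha>) ` D. b \<epsilon> \<otimes> c (- \<epsilon> + (- \<alpha> + \<gamma>)))"
      by (simp add: minus_sum)
    also have "\<dots> = conv b c (- \<alpha> + \<gamma>)"
    proof (rule conv_eq[OF b c, symmetric])
      show "{\<beta>. b \<beta> \<noteq> \<zero>} \<subseteq> (+) (- \<alpha>) ` D"
      proof
        fix \<beta> assume "\<beta> \<in> {\<beta>. b \<beta> \<noteq> \<zero>}"
        then have "\<alpha> + \<beta> \<in> D" using that by (auto simp: D_def B_def)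
        then show "\<beta> \<in> (+) (- \<alpha>) ` D" by (intro image_eqI[of _ _ "\<alpha> + \<beta>"]) simp_all
      qed
    qed (use fin in simp)
    finally show ?thesis .
  qed
  have "conv (conv a b) c \<gamma> = (\<Oplus>\<delta>\<in>D. conv a b \<delta> \<otimes> c (- \<delta> + \<gamma>))"
    using fin by (intro conv_eq conv_fam a b c) (auto simp: D_def)
  also have "\<dots> = (\<Oplus>\<delta>\<in>D. \<Oplus>\<alpha>\<in>A. a \<alpha> \<otimes> (b (- \<alpha> + \<delta>) \<otimes> c (- \<delta> + \<gamma>)))"
  proof (intro finsum_cong' refl)
    fix \<delta>
    have "conv a b \<delta> \<otimes> c (- \<delta> + \<gamma>) = (\<Oplus>\<alpha>\<in>A. a \<alpha> \<otimes> b (- \<alpha> + \<delta>)) \<otimes> c (- \<delta> + \<gamma>)"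
      by (simp add: conv_def A_def)
    also have "\<dots> = (\<Oplus>\<alpha>\<in>A. a \<alpha> \<otimes> b (- \<alpha> + \<delta>) \<otimes> c (- \<delta> + \<gamma>))"
      using fin car by (intro finsum_ldistr) auto
    finally show "conv a b \<delta> \<otimes> c (- \<delta> + \<gamma>) =
        (\<Oplus>\<alpha>\<in>A. a \<alpha> \<otimes> (b (- \<alpha> + \<delta>) \<otimes> c (- \<delta> + \<gamma>)))"
      using car by (simp add: m_assoc)
  qed (use car in \<open>auto intro!: finsum_closed\<close>)
  also have "\<dots> = (\<Oplus>\<alpha>\<in>A. \<Oplus>\<delta>\<in>D. a \<alpha> \<otimes> (b (- \<alpha> + \<delta>) \<otimes> c (- \<delta> + \<gamma>)))"
    using fin car by (intro finsum_swap) auto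
  also have "\<dots> = (\<Oplus>\<alpha>\<in>A. a \<alpha> \<otimes> conv b c (- \<alpha> + \<gamma>))"
  proof (intro finsum_cong' refl)
    fix \<alpha> assume "\<alpha> \<in> A"
    then show "(\<Oplus>\<delta>\<in>D. a \<alpha> \<otimes> (b (- \<alpha> + \<delta>) \<otimes> c (- \<delta> + \<gamma>))) = a \<alpha> \<otimes> conv b c (- \<alpha> + \<gamma>)"
      using fin car by (subst finsum_rdistr[symmetric]) (auto simp: inner)
  qed (use car in auto)
  also have "\<dots> = conv a (conv b c) \<gamma>" by (simp add: conv_def A_def)
  finally show "conv (conv a b) c \<gamma> = conv a (conv b c) \<gamma>" .
qed

lemma conv_add_left:
  assumes a: "a \<in> fam" and b: "b \<in> fam" and c: "c \<in> fam"
  shows "conv (\<lambda>\<gamma>. a \<gamma> \<oplus> b \<gamma>) c = (\<lambda>\<gamma>. conv a c \<gamma> \<oplus> conv b c \<gamma>)"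
proof
  fix \<gamma>
  let ?A = "{\<alpha>. a \<alpha> \<noteq> \<zero>} \<union> {\<alpha>. b \<alpha> \<noteq> \<zero>}"
  note car = famD(2)[OF a] famD(2)[OF b] famD(2)[OF c]
  have fin: "finite ?A" using famD(3) a b by simp
  have "conv (\<lambda>\<gamma>. a \<gamma> \<oplus> b \<gamma>) c \<gamma> = (\<Oplus>\<alpha>\<in>?A. (a \<alpha> \<oplus> b \<alpha>) \<otimes> c (- \<alpha> + \<gamma>))"
    by (rule conv_eq[OF add_fam[OF a b] c fin]) auto
  also have "\<dots> = (\<Oplus>\<alpha>\<in>?A. a \<alpha> \<otimes> c (- \<alpha> + \<gamma>)) \<oplus> (\<Oplus>\<alpha>\<in>?A. b \<alpha> \<otimes> c (- \<alpha> + \<gamma>))"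
    using car by (subst finsum_addf[symmetric]) (auto simp: l_distr)
  also have "\<dots> = conv a c \<gamma> \<oplus> conv b c \<gamma>"
    by (subst (1 2) conv_eq[OF _ c fin]) (use a b in auto)
  finally show "conv (\<lambda>\<gamma>. a \<gamma> \<oplus> b \<gamma>) c \<gamma> = conv a c \<gamma> \<oplus> conv b c \<gamma>" .
qed

lemma conv_add_right:
  assumes a: "a \<in> fam" and b: "b \<in> fam" and c: "c \<in> fam"
  shows "conv c (\<lambda>\<gamma>. a \<gamma> \<oplus> b \<gamma>) = (\<lambda>\<gamma>. conv c a \<gamma> \<oplus> conv c b \<gamma>)"
  unfolding conv_def using famD(2)[OF a] famD(2)[OF b] famD(2)[OF c]
  by (subst finsum_addf[symmetric]) (auto simp: r_distr)

lemma conv_single_left: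
  assumes "x \<in> F \<alpha>" "b \<in> fam" shows "conv (single \<alpha> x) b \<gamma> = x \<otimes> b (- \<alpha> + \<gamma>)"
proof -
  have "conv (single \<alpha> x) b \<gamma> = (\<Oplus>\<beta>\<in>{\<alpha>}. single \<alpha> x \<beta> \<otimes> b (- \<beta> + \<gamma>))"
    using assms by (intro conv_eq single_fam) (auto simp: single_def)
  also have "\<dots> = single \<alpha> x \<alpha> \<otimes> b (- \<alpha> + \<gamma>)"
    using famD(2)[OF single_fam[OF assms(1)]] famD(2)[OF assms(2)] by simp
  finally show ?thesis by (simp add: single_def)
qed

lemma conv_single_right:
  assumes "a \<in> fam" "y \<in> F \<beta>" shows "conv a (single \<beta> y) \<gamma> = a (\<gamma> - \<beta>) \<otimes> y"
proof -
  let ?A = "insert (\<gamma> - \<beta>) {\<alpha>. a \<alpha> \<noteq> \<zero>}"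
  note car = famD(2)[OF assms(1)] F_carrier[OF assms(2)]
  have other: "- \<alpha> + \<gamma> = \<beta> \<longleftrightarrow> \<alpha> = \<gamma> - \<beta>" for \<alpha>
    by (metis add_diff_cancel diff_add_cancel add_minus_cancel minus_add_cancel)
  have "conv a (single \<beta> y) \<gamma> = (\<Oplus>\<alpha>\<in>?A. a \<alpha> \<otimes> single \<beta> y (- \<alpha> + \<gamma>))"
    using assms famD(3)[OF assms(1)] by (intro conv_eq single_fam) auto
  also have "\<dots> = (\<Oplus>\<alpha>\<in>{\<gamma> - \<beta>}. a \<alpha> \<otimes> y)"
    using famD(3)[OF assms(1)] car other
    by (intro add.finprod_mono_neutral_cong_right) (auto simp: single_def)
  finally show ?thesis using car by simp
qed

lemma conv_single_single:
  assumes "x \<in> F \<alpha>" "y \<in> F \<beta>"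
  shows "conv (single \<alpha> x) (single \<beta> y) = single (\<alpha> + \<beta>) (x \<otimes> y)"
proof
  fix \<gamma>
  have "- \<alpha> + \<gamma> = \<beta> \<longleftrightarrow> \<gamma> = \<alpha> + \<beta>" by (metis add_minus_cancel minus_add_cancel)
  then show "conv (single \<alpha> x) (single \<beta> y) \<gamma> = single (\<alpha> + \<beta>) (x \<otimes> y) \<gamma>"
    using assms by (auto simp: conv_single_left single_fam) (auto simp: single_def)
qed

lemma symbol_carrier: "a \<in> fam \<Longrightarrow> symbol a \<in> carrier Gr"
  by (auto simp: assoc_gr_def symbol_def filt_quot_carrier fam_def elim!: finite_subset[rotated])

text \<open>
  Choosing \<open>\<zero>\<close> in every trivial coset makes the support of the representing family the support of
  the element.
\<close>

lemma Gr_carrierE: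
  assumes "f \<in> carrier Gr"
  obtains a where "a \<in> fam" "f = symbol a" "\<And>\<gamma>. a \<gamma> \<in> below \<gamma> \<Longrightarrow> a \<gamma> = \<zero>"
proof -
  have f: "\<And>\<gamma>. f \<gamma> \<in> (\<lambda>x. below \<gamma> +> x) ` F \<gamma>" and fin: "finite {\<gamma>. f \<gamma> \<noteq> below \<gamma>}"
    using assms by (auto simp: assoc_gr_def filt_quot_carrier)
  have "\<exists>x\<in>F \<gamma>. f \<gamma> = below \<gamma> +> x \<and> (x \<in> below \<gamma> \<longrightarrow> x = \<zero>)" for \<gamma>
  proof (cases "f \<gamma> = below \<gamma>")
    case True then show ?thesis by (intro bexI[of _ \<zero>]) auto
  next
    case False
    obtain x where "x \<in> F \<gamma>" "f \<gamma> = below \<gamma> +> x" using f by blast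
    moreover from this have "x \<notin> below \<gamma>" using False by (auto simp: coset_trivial_iff)
    ultimately show ?thesis by blast
  qed
  then obtain a where a: "\<And>\<gamma>. a \<gamma> \<in> F \<gamma>" "\<And>\<gamma>. f \<gamma> = below \<gamma> +> a \<gamma>"
      "\<And>\<gamma>. a \<gamma> \<in> below \<gamma> \<Longrightarrow> a \<gamma> = \<zero>"
    by metis
  have "{\<gamma>. a \<gamma> \<noteq> \<zero>} \<subseteq> {\<gamma>. f \<gamma> \<noteq> below \<gamma>}"
  proof
    fix \<gamma> assume "\<gamma> \<in> {\<gamma>. a \<gamma> \<noteq> \<zero>}"
    then have "a \<gamma> \<notin> below \<gamma>" using a(3) by auto
    then show "\<gamma> \<in> {\<gamma>. f \<gamma> \<noteq> below \<gamma>}" using a(2) coset_trivial_iff[OF F_carrier[OF a(1)]] by simp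
  qed
  then have "a \<in> fam" using a(1) fin finite_subset by (auto simp: fam_def)
  moreover have "f = symbol a" using a(2) by (simp add: symbol_def fun_eq_iff)
  ultimately show thesis using that a(3) by blast
qed

lemma Gr_zero: "\<zero>\<^bsub>Gr\<^esub> = symbol (\<lambda>_. \<zero>)"
  by (simp add: assoc_gr_def symbol_def)

lemma Gr_zero_apply [simp]: "\<zero>\<^bsub>Gr\<^esub> \<gamma> = below \<gamma>"
  by (simp add: assoc_gr_def)

lemma Gr_add_apply [simp]: "(f \<oplus>\<^bsub>Gr\<^esub> g) \<gamma> = set_add R (f \<gamma>) (g \<gamma>)"
  by (simp add: assoc_gr_def)

lemma Gr_one: "\<one>\<^bsub>Gr\<^esub> = symbol (single 0 \<one>)"
  by (simp add: assoc_gr_def symbol_def single_def fun_eq_iff)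

lemma symbol_add:
  assumes "a \<in> fam" "b \<in> fam" shows "symbol a \<oplus>\<^bsub>Gr\<^esub> symbol b = symbol (\<lambda>\<gamma>. a \<gamma> \<oplus> b \<gamma>)"
  using famD(2)[OF assms(1)] famD(2)[OF assms(2)] by (simp add: assoc_gr_def symbol_def)

text \<open>
  The product of the associated graded ring runs over the degrees with nontrivial coset, the
  convolution over the possibly larger support of \<open>a\<close>; the additional terms lie in lower degree.
\<close>

lemma symbol_mult:
  assumes a: "a \<in> fam" and b: "b \<in> fam" shows "symbol a \<otimes>\<^bsub>Gr\<^esub> symbol b = symbol (conv a b)"
proof
  fix \<gamma>
  interpret Q: comm_monoid "filt_quot R F \<gamma>" by (rule filt_quot_comm_monoid)
  let ?t = "\<lambda>\<alpha>. below \<gamma> +> (a \<alpha> \<otimes> b (- \<alpha> + \<gamma>))"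
  have "rcoset_mult R (below \<gamma>) (symbol a \<alpha>) (symbol b (- \<alpha> + \<gamma>)) = ?t \<alpha>" for \<alpha>
    unfolding symbol_def using a b famD by (intro rcoset_mult_coset) auto
  then have "(symbol a \<otimes>\<^bsub>Gr\<^esub> symbol b) \<gamma> = finprod (filt_quot R F \<gamma>) ?t {\<alpha>. symbol a \<alpha> \<noteq> below \<alpha>}"
    by (simp add: assoc_gr_def)
  also have "\<dots> = finprod (filt_quot R F \<gamma>) ?t {\<alpha>. a \<alpha> \<noteq> \<zero>}"
  proof (rule Q.finprod_mono_neutral_cong_left)
    fix \<alpha> assume "\<alpha> \<in> {\<alpha>. a \<alpha> \<noteq> \<zero>} - {\<alpha>. symbol a \<alpha> \<noteq> below \<alpha>}"
    then have "a \<alpha> \<in> below \<alpha>" using famD(2)[OF a] coset_trivial_iff by (auto simp: symbol_def)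
    then have "a \<alpha> \<otimes> b (- \<alpha> + \<gamma>) \<in> below \<gamma>"
      using below_mult_F[of "a \<alpha>" \<alpha> _ "- \<alpha> + \<gamma>"] famD(1)[OF b] by simp
    then show "?t \<alpha> = \<one>\<^bsub>filt_quot R F \<gamma>\<^esub>"
      using famD(2)[OF a] famD(2)[OF b] coset_trivial_iff by simp
  qed (use famD(3)[OF a] conv_term[OF a b] in \<open>auto simp: filt_quot_carrier symbol_def\<close>)
  also have "\<dots> = symbol (conv a b) \<gamma>"
    using famD(3)[OF a] conv_term[OF a b] by (simp add: finprod_coset symbol_def conv_def)
  finally show "(symbol a \<otimes>\<^bsub>Gr\<^esub> symbol b) \<gamma> = symbol (conv a b) \<gamma>" .
qed

lemma symbol_eq_zero_iff:
  assumes "a \<in> fam" shows "symbol a = \<zero>\<^bsub>Gr\<^esub> \<longleftrightarrow> (\<forall>\<gamma>. a \<gamma> \<in> below \<gamma>)"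
  unfolding Gr_zero using famD(2)[OF assms] by (simp add: symbol_def fun_eq_iff coset_trivial_iff)

theorem assoc_gr_ring: "ring Gr"
proof -
  have one_fam: "single 0 \<one> \<in> fam" using filtration_one by (rule single_fam)
  note simps = symbol_carrier symbol_add symbol_mult conv_fam add_fam
  show ?thesis
  proof (rule ringI)
    show "abelian_group Gr"
    proof (rule abelian_groupI)
      fix f g h assume "f \<in> carrier Gr" "g \<in> carrier Gr" "h \<in> carrier Gr"
      then obtain a b c where "a \<in> fam" "b \<in> fam" "c \<in> fam" "f = symbol a" "g = symbol b" "h = symbol c"
        by (metis Gr_carrierE)
      then show "f \<oplus>\<^bsub>Gr\<^esub> g \<oplus>\<^bsub>Gr\<^esub> h = f \<oplus>\<^bsub>Gr\<^esub> (g \<oplus>\<^bsub>Gr\<^esub> h)"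
        using famD(2) by (simp add: simps a_assoc)
    next
      fix f g assume "f \<in> carrier Gr" "g \<in> carrier Gr"
      then obtain a b where "a \<in> fam" "b \<in> fam" "f = symbol a" "g = symbol b"
        by (metis Gr_carrierE)
      then show "f \<oplus>\<^bsub>Gr\<^esub> g \<in> carrier Gr" "f \<oplus>\<^bsub>Gr\<^esub> g = g \<oplus>\<^bsub>Gr\<^esub> f"
        using famD(2) by (simp_all add: simps a_comm)
    next
      fix f assume "f \<in> carrier Gr"
      then obtain a where a: "a \<in> fam" "f = symbol a" by (metis Gr_carrierE)
      then show "\<zero>\<^bsub>Gr\<^esub> \<oplus>\<^bsub>Gr\<^esub> f = f" using famD(2) by (simp add: Gr_zero simps zero_fam)
      show "\<exists>g\<in>carrier Gr. g \<oplus>\<^bsub>Gr\<^esub> f = \<zero>\<^bsub>Gr\<^esub>"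
        using a famD(2) neg_fam[OF a(1)]
        by (intro bexI[of _ "symbol (\<lambda>\<gamma>. \<ominus> a \<gamma>)"]) (simp_all add: Gr_zero simps l_neg)
    qed (simp add: Gr_zero simps zero_fam)
    show "monoid Gr"
    proof (rule monoidI)
      fix f g h assume "f \<in> carrier Gr" "g \<in> carrier Gr" "h \<in> carrier Gr"
      then obtain a b c where "a \<in> fam" "b \<in> fam" "c \<in> fam" "f = symbol a" "g = symbol b" "h = symbol c"
        by (metis Gr_carrierE)
      then show "f \<otimes>\<^bsub>Gr\<^esub> g \<otimes>\<^bsub>Gr\<^esub> h = f \<otimes>\<^bsub>Gr\<^esub> (g \<otimes>\<^bsub>Gr\<^esub> h)"
        by (simp add: simps conv_assoc)
    next
      fix f g assume "f \<in> carrier Gr" "g \<in> carrier Gr"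
      then obtain a b where "a \<in> fam" "b \<in> fam" "f = symbol a" "g = symbol b"
        by (metis Gr_carrierE)
      then show "f \<otimes>\<^bsub>Gr\<^esub> g \<in> carrier Gr" by (simp add: simps)
    next
      fix f assume "f \<in> carrier Gr"
      then obtain a where a: "a \<in> fam" "f = symbol a" by (metis Gr_carrierE)
      have "conv (single 0 \<one>) a = a" "conv a (single 0 \<one>) = a"
        using a famD(2)[OF a(1)] filtration_one
        by (simp_all add: fun_eq_iff conv_single_left conv_single_right)
      then show "\<one>\<^bsub>Gr\<^esub> \<otimes>\<^bsub>Gr\<^esub> f = f" "f \<otimes>\<^bsub>Gr\<^esub> \<one>\<^bsub>Gr\<^esub> = f"
        using a one_fam by (simp_all add: Gr_one simps)
    qed (simp add: Gr_one simps one_fam)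
    fix f g h assume "f \<in> carrier Gr" "g \<in> carrier Gr" "h \<in> carrier Gr"
    then obtain a b c where "a \<in> fam" "b \<in> fam" "c \<in> fam" "f = symbol a" "g = symbol b" "h = symbol c"
      by (metis Gr_carrierE)
    then show "(f \<oplus>\<^bsub>Gr\<^esub> g) \<otimes>\<^bsub>Gr\<^esub> h = f \<otimes>\<^bsub>Gr\<^esub> h \<oplus>\<^bsub>Gr\<^esub> g \<otimes>\<^bsub>Gr\<^esub> h"
      "h \<otimes>\<^bsub>Gr\<^esub> (f \<oplus>\<^bsub>Gr\<^esub> g) = h \<otimes>\<^bsub>Gr\<^esub> f \<oplus>\<^bsub>Gr\<^esub> h \<otimes>\<^bsub>Gr\<^esub> g"
      by (simp_all add: simps conv_add_left conv_add_right)
  qed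
qed

section \<open>The grading\<close>

abbreviation homog :: "'g \<Rightarrow> 'a \<Rightarrow> 'g \<Rightarrow> 'a set" where
  "homog \<gamma> x \<equiv> symbol (single \<gamma> x)"

lemma homog_apply: "homog \<gamma> x \<delta> = (if \<delta> = \<gamma> then below \<gamma> +> x else below \<delta>)"
  by (simp add: symbol_def single_def)

lemma homog_zero_iff: "x \<in> F \<gamma> \<Longrightarrow> homog \<gamma> x = \<zero>\<^bsub>Gr\<^esub> \<longleftrightarrow> x \<in> below \<gamma>"
  using symbol_eq_zero_iff[OF single_fam, of x \<gamma>] by (auto simp: single_def)

lemma homog_mult:
  "\<lbrakk>x \<in> F \<alpha>; y \<in> F \<beta>\<rbrakk> \<Longrightarrow> homog \<alpha> x \<otimes>\<^bsub>Gr\<^esub> homog \<beta> y = homog (\<alpha> + \<beta>) (x \<otimes> y)"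
  by (simp add: symbol_mult single_fam conv_single_single)

lemma homog_add:
  assumes "x \<in> F \<gamma>" "y \<in> F \<gamma>"
  shows "homog \<gamma> x \<oplus>\<^bsub>Gr\<^esub> homog \<gamma> y = homog \<gamma> (x \<oplus> y)"
proof -
  have "(\<lambda>\<delta>. single \<gamma> x \<delta> \<oplus> single \<gamma> y \<delta>) = single \<gamma> (x \<oplus> y)"
    by (simp add: single_def fun_eq_iff)
  then show ?thesis using assms by (simp add: symbol_add single_fam)
qed

lemma homog_carrier: "x \<in> F \<gamma> \<Longrightarrow> homog \<gamma> x \<in> carrier Gr"
  by (simp add: symbol_carrier single_fam)

lemma Gr_comp_eq: "Gr_comp \<gamma> = homog \<gamma> ` F \<gamma>"
proof
  show "homog \<gamma> ` F \<gamma> \<subseteq> Gr_comp \<gamma>"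
    by (auto simp: assoc_gr_component_def homog_carrier homog_apply)
  show "Gr_comp \<gamma> \<subseteq> homog \<gamma> ` F \<gamma>"
  proof
    fix f assume f: "f \<in> Gr_comp \<gamma>"
    then have "f \<in> carrier Gr" by (simp add: assoc_gr_component_def)
    then obtain a where a: "a \<in> fam" "f = symbol a" by (rule Gr_carrierE)
    have "f = homog \<gamma> (a \<gamma>)"
    proof
      fix \<delta>
      show "f \<delta> = homog \<gamma> (a \<gamma>) \<delta>"
        using f a(2) by (cases "\<delta> = \<gamma>") (auto simp: assoc_gr_component_def symbol_def single_def)
    qed
    then show "f \<in> homog \<gamma> ` F \<gamma>" using famD(1)[OF a(1)] by blast
  qed
qed

lemma gr_support_iff: "\<gamma> \<in> gr_support R F \<longleftrightarrow> (\<exists>x. x \<in> F \<gamma> \<and> x \<notin> below \<gamma>)"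
proof -
  have "\<zero>\<^bsub>Gr\<^esub> \<in> Gr_comp \<gamma>"
    unfolding Gr_comp_eq using homog_zero_iff[of \<zero> \<gamma>] by (intro image_eqI[of _ _ \<zero>]) auto
  then have "\<gamma> \<in> gr_support R F \<longleftrightarrow> (\<exists>f\<in>Gr_comp \<gamma>. f \<noteq> \<zero>\<^bsub>Gr\<^esub>)"
    unfolding gr_support_def by blast
  then show ?thesis by (auto simp: Gr_comp_eq homog_zero_iff)
qed

lemma Gr_comp_additive_subgroup: "additive_subgroup (Gr_comp \<gamma>) Gr"
proof -
  interpret G: ring Gr by (rule assoc_gr_ring)
  show ?thesis
  proof (intro additive_subgroupI G.add.subgroupI)
    show "Gr_comp \<gamma> \<subseteq> carrier Gr" by (auto simp: Gr_comp_eq homog_carrier)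
    show "Gr_comp \<gamma> \<noteq> {}" unfolding Gr_comp_eq using Fsub.zero_closed[of \<gamma>] by blast
    fix f assume "f \<in> Gr_comp \<gamma>"
    then obtain x where x: "x \<in> F \<gamma>" "f = homog \<gamma> x" by (auto simp: Gr_comp_eq)
    have "homog \<gamma> (\<ominus> x) \<oplus>\<^bsub>Gr\<^esub> f = \<zero>\<^bsub>Gr\<^esub>"
      using x by (simp add: homog_add l_neg F_carrier homog_zero_iff)
    then have "\<ominus>\<^bsub>Gr\<^esub> f = homog \<gamma> (\<ominus> x)"
      using x by (intro G.minus_equality) (auto simp: homog_carrier)
    then show "\<ominus>\<^bsub>Gr\<^esub> f \<in> Gr_comp \<gamma>" using x by (auto simp: Gr_comp_eq)
    fix g assume "g \<in> Gr_comp \<gamma>"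
    then show "f \<oplus>\<^bsub>Gr\<^esub> g \<in> Gr_comp \<gamma>" using x by (auto simp: Gr_comp_eq homog_add)
  qed
qed

text \<open>
  At degree \<open>\<delta>\<close> only the summand of degree \<open>\<delta>\<close> is nontrivial. Hence a decomposition into
  homogeneous elements can be read off from the values, which gives its existence and uniqueness.
\<close>

lemma finsum_homogeneous_apply:
  assumes "finite T" "\<And>\<gamma>. \<gamma> \<in> T \<Longrightarrow> f \<gamma> \<in> Gr_comp \<gamma>"
  shows "(\<Oplus>\<^bsub>Gr\<^esub>\<gamma>\<in>T. f \<gamma>) \<delta> = (if \<delta> \<in> T then f \<delta> \<delta> else below \<delta>)"
proof -
  interpret G: ring Gr by (rule assoc_gr_ring)
  have carr: "Gr_comp \<gamma> \<subseteq> carrier Gr" for \<gamma> by (auto simp: assoc_gr_component_def)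
  show ?thesis
    using assms
  proof (induction T rule: finite_induct)
    case empty then show ?case by simp
  next
    case (insert \<beta> T)
    have f\<beta>: "f \<beta> \<in> Gr_comp \<beta>" using insert.prems by simp
    then obtain x where x: "x \<in> F \<beta>" "f \<beta> = homog \<beta> x" by (auto simp: Gr_comp_eq)
    have "(\<Oplus>\<^bsub>Gr\<^esub>\<gamma>\<in>insert \<beta> T. f \<gamma>) = f \<beta> \<oplus>\<^bsub>Gr\<^esub> (\<Oplus>\<^bsub>Gr\<^esub>\<gamma>\<in>T. f \<gamma>)"
      using insert carr by (subst G.finsum_insert) auto
    then have eq: "(\<Oplus>\<^bsub>Gr\<^esub>\<gamma>\<in>insert \<beta> T. f \<gamma>) \<delta>
        = set_add R (f \<beta> \<delta>) (if \<delta> \<in> T then f \<delta> \<delta> else below \<delta>)"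
      using insert by simp
    show ?case
    proof (cases "\<delta> = \<beta>")
      case True then show ?thesis
        using eq insert.hyps x by (simp add: homog_apply F_carrier)
    next
      case False
      have "\<exists>y\<in>carrier R. (if \<delta> \<in> T then f \<delta> \<delta> else below \<delta>) = below \<delta> +> y"
      proof (cases "\<delta> \<in> T")
        case True
        then obtain y where "y \<in> F \<delta>" "f \<delta> = homog \<delta> y"
          using insert.prems[of \<delta>] by (auto simp: Gr_comp_eq)
        then show ?thesis using True by (intro bexI[of _ y]) (auto simp: homog_apply)
      qed (intro bexI[of _ \<zero>], auto)
      then have "set_add R (below \<delta>) (if \<delta> \<in> T then f \<delta> \<delta> else below \<delta>)
          = (if \<delta> \<in> T then f \<delta> \<delta> else below \<delta>)"
        using coset_add_below(1) by metis
      then show ?thesis using False eq x by (simp add: homog_apply)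
    qed
  qed
qed

text \<open>
  The statement is for an index subgroup \<open>S\<close> because both \<open>S = \<Gamma>\<close> and
  \<open>S = \<Gamma>\<^sub>s\<close> occur: the components outside the support vanish, so any subgroup that contains the
  support carries the same decomposition.
\<close>

lemma assoc_gr_graded:
  assumes S: "add_subgroup S" and supp: "gr_support R F \<subseteq> S"
  shows "graded_ring S Gr Gr_comp"
proof -
  interpret G: ring Gr by (rule assoc_gr_ring)
  have unique: "\<exists>!f. (\<forall>\<gamma>\<in>S. f \<gamma> \<in> Gr_comp \<gamma>) \<and> (\<forall>\<gamma>. \<gamma> \<notin> S \<longrightarrow> f \<gamma> = \<zero>\<^bsub>Gr\<^esub>) \<and>
      finite {\<gamma>. f \<gamma> \<noteq> \<zero>\<^bsub>Gr\<^esub>} \<and> x = (\<Oplus>\<^bsub>Gr\<^esub>\<gamma>\<in>{\<gamma>. f \<gamma> \<noteq> \<zero>\<^bsub>Gr\<^esub>}. f \<gamma>)"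
    (is "\<exists>!f. ?P f") if x: "x \<in> carrier Gr" for x
  proof -
    obtain a where a: "a \<in> fam" "x = symbol a" "\<And>\<gamma>. a \<gamma> \<in> below \<gamma> \<Longrightarrow> a \<gamma> = \<zero>"
      using Gr_carrierE[OF x] by metis
    define p where "p \<gamma> = homog \<gamma> (a \<gamma>)" for \<gamma>
    have p_comp: "p \<gamma> \<in> Gr_comp \<gamma>" for \<gamma>
      unfolding Gr_comp_eq p_def using famD(1)[OF a(1)] by blast
    have p_zero: "p \<gamma> = \<zero>\<^bsub>Gr\<^esub> \<longleftrightarrow> a \<gamma> = \<zero>" for \<gamma>
      unfolding p_def using homog_zero_iff[OF famD(1)[OF a(1)]] a(3) by auto
    show ?thesis
    proof (rule ex1I[of _ p])
      have fin: "finite {\<gamma>. p \<gamma> \<noteq> \<zero>\<^bsub>Gr\<^esub>}" using famD(3)[OF a(1)] by (simp add: p_zero)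
      have "x = (\<Oplus>\<^bsub>Gr\<^esub>\<gamma>\<in>{\<gamma>. p \<gamma> \<noteq> \<zero>\<^bsub>Gr\<^esub>}. p \<gamma>)"
      proof
        fix \<delta>
        show "x \<delta> = (\<Oplus>\<^bsub>Gr\<^esub>\<gamma>\<in>{\<gamma>. p \<gamma> \<noteq> \<zero>\<^bsub>Gr\<^esub>}. p \<gamma>) \<delta>"
          using finsum_homogeneous_apply[OF fin p_comp, of \<delta>] a(2)
          by (auto simp: p_zero) (auto simp: p_def symbol_def single_def)
      qed
      moreover have "p \<gamma> = \<zero>\<^bsub>Gr\<^esub>" if "\<gamma> \<notin> S" for \<gamma>
        using that supp gr_support_iff famD(1)[OF a(1)] a(3) p_zero by blast
      ultimately show "?P p" using p_comp fin by auto
    next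
      fix f assume f: "?P f"
      have f_comp: "f \<gamma> \<in> Gr_comp \<gamma>" if "\<gamma> \<in> {\<gamma>. f \<gamma> \<noteq> \<zero>\<^bsub>Gr\<^esub>}" for \<gamma>
        using f that by auto
      have x_eq: "x = (\<Oplus>\<^bsub>Gr\<^esub>\<gamma>\<in>{\<gamma>. f \<gamma> \<noteq> \<zero>\<^bsub>Gr\<^esub>}. f \<gamma>)" using f by blast
      have f_diag: "f \<delta> \<delta> = x \<delta>" for \<delta>
      proof (cases "f \<delta> = \<zero>\<^bsub>Gr\<^esub>")
        case True
        then show ?thesis
          using finsum_homogeneous_apply[OF _ f_comp, of "{\<gamma>. f \<gamma> \<noteq> \<zero>\<^bsub>Gr\<^esub>}" \<delta>] f
          by (subst x_eq) simp
      next
        case False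
        then show ?thesis
          using finsum_homogeneous_apply[OF _ f_comp, of "{\<gamma>. f \<gamma> \<noteq> \<zero>\<^bsub>Gr\<^esub>}" \<delta>] f
          by (subst x_eq) simp
      qed
      have "f \<gamma> \<delta> = p \<gamma> \<delta>" for \<gamma> \<delta>
      proof (cases "\<delta> = \<gamma>")
        case True
        then show ?thesis using f_diag a(2) by (simp add: p_def symbol_def single_def)
      next
        case False
        then have "f \<gamma> \<delta> = below \<delta>"
          using f_comp[of \<gamma>] by (cases "f \<gamma> = \<zero>\<^bsub>Gr\<^esub>") (auto simp: assoc_gr_component_def)
        then show ?thesis using False by (simp add: p_def homog_apply)
      qed
      then show "f = p" by blast
    qed
  qed
  show ?thesis
  proof (rule graded_ring.intro[OF assoc_gr_ring], rule graded_ring_axioms.intro)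
    fix \<gamma> \<delta> x y assume "x \<in> Gr_comp \<gamma>" "y \<in> Gr_comp \<delta>"
    then show "x \<otimes>\<^bsub>Gr\<^esub> y \<in> Gr_comp (\<gamma> + \<delta>)"
      by (auto simp: Gr_comp_eq homog_mult filtration_mult)
  next
    show "\<one>\<^bsub>Gr\<^esub> \<in> Gr_comp 0" unfolding Gr_one Gr_comp_eq using filtration_one by blast
  qed (rule S | rule Gr_comp_additive_subgroup | erule unique)+
qed

section \<open>Multiplicativity of the degree\<close>

text \<open>
  If the degree of \<open>a\<close> is the \<open>\<gamma>\<close> with \<open>a \<in> F \<gamma> - below \<gamma>\<close>, this says that the degree of a
  product is the sum of the degrees. Each of the three conditions in the main theorem is shown
  to hold if and only if \<open>R\<close> is a skewfield with this property.
\<close>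

definition mult_degree :: bool where
  "mult_degree \<longleftrightarrow> (\<forall>\<alpha> \<beta> a b. a \<in> F \<alpha> - below \<alpha> \<longrightarrow> b \<in> F \<beta> - below \<beta> \<longrightarrow>
     a \<otimes> b \<notin> below (\<alpha> + \<beta>))"

lemma mult_degreeD:
  "\<lbrakk>mult_degree; a \<in> F \<alpha>; a \<notin> below \<alpha>; b \<in> F \<beta>; b \<notin> below \<beta>\<rbrakk> \<Longrightarrow> a \<otimes> b \<notin> below (\<alpha> + \<beta>)"
  by (simp add: mult_degree_def)

lemma degree_exists:
  assumes "separated_filtration R F" "a \<in> carrier R" "a \<noteq> \<zero>"
  obtains \<gamma> where "a \<in> F \<gamma>" "a \<notin> below \<gamma>"
  using assms unfolding separated_filtration_def by blast

text \<open>
  If \<open>1\<close> had negative degree, multiplication by \<open>1\<close> would lower the degree of \<open>1\<close>.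
\<close>

lemma one_notin_below:
  assumes sep: "separated_filtration R F" and "\<one> \<noteq> \<zero>" shows "\<one> \<notin> below 0"
proof
  assume one: "\<one> \<in> below 0"
  obtain \<gamma> where \<gamma>: "\<one> \<in> F \<gamma>" "\<one> \<notin> below \<gamma>"
    using degree_exists[OF sep one_closed \<open>\<one> \<noteq> \<zero>\<close>] .
  have "\<one> \<otimes> \<one> \<in> below (\<gamma> + 0)" using \<gamma>(1) one by (rule F_mult_below)
  then show False using \<gamma> by simp
qed

lemma Gr_one_eq_zero_iff: "\<one>\<^bsub>Gr\<^esub> = \<zero>\<^bsub>Gr\<^esub> \<longleftrightarrow> \<one> \<in> below 0"
  unfolding Gr_one using filtration_one by (rule homog_zero_iff)

lemma nc_domain_Gr_imp_mult_degree:
  assumes "nc_domain Gr" shows mult_degree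
  unfolding mult_degree_def
proof (intro allI impI notI)
  fix \<alpha> \<beta> a b
  assume a: "a \<in> F \<alpha> - below \<alpha>" and b: "b \<in> F \<beta> - below \<beta>" and ab: "a \<otimes> b \<in> below (\<alpha> + \<beta>)"
  have "homog \<alpha> a \<otimes>\<^bsub>Gr\<^esub> homog \<beta> b = \<zero>\<^bsub>Gr\<^esub>"
    using a b ab by (simp add: homog_mult homog_zero_iff filtration_mult)
  then have "homog \<alpha> a = \<zero>\<^bsub>Gr\<^esub> \<or> homog \<beta> b = \<zero>\<^bsub>Gr\<^esub>"
    using assms a b homog_carrier by (simp add: nc_domain_def)
  then show False using a b by (auto simp: homog_zero_iff)
qed

text \<open>
  Leading terms: if \<open>\<alpha>\<close> and \<open>\<beta>\<close> are the largest degrees in \<open>f\<close> and \<open>g\<close>, only the pair \<open>(\<alpha>, \<beta>)\<close>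
  contributes to the degree \<open>\<alpha> + \<beta>\<close> of \<open>f g\<close>, so nothing can cancel there.
\<close>

lemma mult_degree_imp_nc_domain_Gr:
  assumes md: mult_degree and one: "\<one> \<notin> below 0" shows "nc_domain Gr"
  unfolding nc_domain_def
proof (intro conjI ballI impI assoc_gr_ring)
  show "\<one>\<^bsub>Gr\<^esub> \<noteq> \<zero>\<^bsub>Gr\<^esub>" using one by (simp add: Gr_one_eq_zero_iff)
  fix f g assume f: "f \<in> carrier Gr" and g: "g \<in> carrier Gr" and fg: "f \<otimes>\<^bsub>Gr\<^esub> g = \<zero>\<^bsub>Gr\<^esub>"
  obtain a where a: "a \<in> fam" "f = symbol a" "\<And>\<gamma>. a \<gamma> \<in> below \<gamma> \<Longrightarrow> a \<gamma> = \<zero>"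
    using Gr_carrierE[OF f] by metis
  obtain b where b: "b \<in> fam" "g = symbol b" "\<And>\<gamma>. b \<gamma> \<in> below \<gamma> \<Longrightarrow> b \<gamma> = \<zero>"
    using Gr_carrierE[OF g] by metis
  show "f = \<zero>\<^bsub>Gr\<^esub> \<or> g = \<zero>\<^bsub>Gr\<^esub>"
  proof (rule ccontr)
    assume "\<not> ?thesis"
    then have nonempty: "{\<alpha>. a \<alpha> \<noteq> \<zero>} \<noteq> {}" "{\<beta>. b \<beta> \<noteq> \<zero>} \<noteq> {}"
      using symbol_eq_zero_iff[OF a(1)] symbol_eq_zero_iff[OF b(1)] a(2) b(2) by force+
    note fin = famD(3)[OF a(1)] famD(3)[OF b(1)]
    define \<alpha> where "\<alpha> = Max {\<alpha>. a \<alpha> \<noteq> \<zero>}"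
    define \<beta> where "\<beta> = Max {\<beta>. b \<beta> \<noteq> \<zero>}"
    have top: "a \<alpha> \<noteq> \<zero>" "b \<beta> \<noteq> \<zero>"
      using Max_in[OF fin(1) nonempty(1)] Max_in[OF fin(2) nonempty(2)]
      by (simp_all add: \<alpha>_def \<beta>_def)
    have above: "\<delta> \<le> \<alpha>" if "a \<delta> \<noteq> \<zero>" for \<delta>
      unfolding \<alpha>_def using fin(1) that by simp
    have above': "b \<delta> = \<zero>" if "\<beta> < \<delta>" for \<delta>
    proof (rule ccontr)
      assume "b \<delta> \<noteq> \<zero>"
      then have "\<delta> \<le> \<beta>" unfolding \<beta>_def using fin(2) by simp
      then show False using that by simp
    qed
    have vanish: "b (- \<delta> + (\<alpha> + \<beta>)) = \<zero>" if "a \<delta> \<noteq> \<zero>" "\<delta> \<noteq> \<alpha>" for \<delta>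
    proof (rule above')
      have "\<delta> < \<alpha>" using above[OF that(1)] that(2) by simp
      then have "- \<delta> + (\<delta> + \<beta>) < - \<delta> + (\<alpha> + \<beta>)"
        by (intro group_add_strict_left_mono group_add_strict_right_mono)
      then show "\<beta> < - \<delta> + (\<alpha> + \<beta>)" by simp
    qed
    note car = famD(2)[OF a(1)] famD(2)[OF b(1)]
    have "conv a b (\<alpha> + \<beta>) = (\<Oplus>\<delta>\<in>{\<alpha>}. a \<delta> \<otimes> b (- \<delta> + (\<alpha> + \<beta>)))"
      unfolding conv_def using fin top vanish car
      by (intro add.finprod_mono_neutral_cong_right) auto
    also have "\<dots> = a \<alpha> \<otimes> b \<beta>" using car by simp
    finally have "a \<alpha> \<otimes> b \<beta> \<in> below (\<alpha> + \<beta>)"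
      using fg a(2) b(2) a(1) b(1) symbol_eq_zero_iff[OF conv_fam[OF a(1) b(1)]]
      by (simp add: symbol_mult) metis
    then show False
      using mult_degreeD[OF md] famD(1)[OF a(1)] famD(1)[OF b(1)] a(3) b(3) top by blast
  qed
qed

lemma gr_skewfield_imp_mult_degree:
  assumes "gr_skewfield UNIV Gr Gr_comp" shows mult_degree
  unfolding mult_degree_def
proof (intro allI impI notI)
  interpret G: ring Gr by (rule assoc_gr_ring)
  fix \<alpha> \<beta> a b
  assume a: "a \<in> F \<alpha> - below \<alpha>" and b: "b \<in> F \<beta> - below \<beta>" and ab: "a \<otimes> b \<in> below (\<alpha> + \<beta>)"
  have "homog \<alpha> a \<in> Units Gr"
    using assms a homog_zero_iff unfolding gr_skewfield_def Gr_comp_eq by blast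
  moreover have "homog \<alpha> a \<otimes>\<^bsub>Gr\<^esub> homog \<beta> b = homog \<alpha> a \<otimes>\<^bsub>Gr\<^esub> \<zero>\<^bsub>Gr\<^esub>"
    using a b ab homog_carrier by (simp add: homog_mult homog_zero_iff filtration_mult)
  ultimately have "homog \<beta> b = \<zero>\<^bsub>Gr\<^esub>"
    using b homog_carrier by (simp add: G.Units_l_cancel)
  then show False using b by (auto simp: homog_zero_iff)
qed

lemma mult_degree_imp_nc_domain:
  assumes sep: "separated_filtration R F" and md: mult_degree and "\<one> \<noteq> \<zero>"
  shows "nc_domain R"
  unfolding nc_domain_def
proof (intro conjI ballI impI ring_axioms \<open>\<one> \<noteq> \<zero>\<close>)
  fix a b assume a: "a \<in> carrier R" and b: "b \<in> carrier R" and ab: "a \<otimes> b = \<zero>"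
  show "a = \<zero> \<or> b = \<zero>"
  proof (rule ccontr)
    assume "\<not> ?thesis"
    then obtain \<alpha> \<beta> where "a \<in> F \<alpha>" "a \<notin> below \<alpha>" "b \<in> F \<beta>" "b \<notin> below \<beta>"
      using degree_exists[OF sep] a b by metis
    then show False using mult_degreeD[OF md, of a \<alpha> b \<beta>] ab by simp
  qed
qed

section \<open>Filtered skewfields with multiplicative degree\<close>

lemma below_nonzero: "x \<notin> below \<gamma> \<Longrightarrow> x \<noteq> \<zero>"
  using Bsub.zero_closed by blast

text \<open>
  Degrees are unique and \<open>1\<close> has degree \<open>0\<close>, so the degrees of \<open>a\<close> and its inverse, which exists
  by separatedness, add up to \<open>0\<close>.
\<close>

lemma degree_inv:
  assumes sep: "separated_filtration R F" and sk: "skewfield R" and md: mult_degree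
    and a: "a \<in> F \<gamma>" "a \<notin> below \<gamma>"
  shows "inv a \<in> F (- \<gamma>)" "inv a \<notin> below (- \<gamma>)"
proof -
  have a': "a \<in> carrier R" "a \<noteq> \<zero>" using a below_nonzero by auto
  note i = skewfieldD[OF sk a']
  obtain \<delta> where \<delta>: "inv a \<in> F \<delta>" "inv a \<notin> below \<delta>" using degree_exists[OF sep i(2,5)] .
  have one: "\<one> \<in> F (\<gamma> + \<delta>)" "\<one> \<notin> below (\<gamma> + \<delta>)"
    using filtration_mult[OF a(1) \<delta>(1)] mult_degreeD[OF md a \<delta>] i by simp_all
  have "\<one> \<notin> below 0" using one_notin_below[OF sep] sk by (simp add: skewfield_def)
  then have "\<gamma> + \<delta> = 0"
    using one filtration_one unfolding below_iff by (metis linorder_neqE)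
  then have "\<delta> = - \<gamma>" by (metis neg_eq_iff_add_eq_0)
  then show "inv a \<in> F (- \<gamma>)" "inv a \<notin> below (- \<gamma>)" using \<delta> by simp_all
qed

lemma F0_subring: "subring (F 0) R"
  using filtration_one filtration_mult[of _ 0 _ 0] by (intro subringI) auto

lemma mult_degree_imp_gr_skewfield:
  assumes sep: "separated_filtration R F" and sk: "skewfield R" and md: mult_degree
  shows "gr_skewfield UNIV Gr Gr_comp"
  unfolding gr_skewfield_def
proof (intro conjI ballI impI)
  show "graded_ring UNIV Gr Gr_comp" by (intro assoc_gr_graded) (auto simp: add_subgroup_def)
  show "\<one>\<^bsub>Gr\<^esub> \<noteq> \<zero>\<^bsub>Gr\<^esub>"
    using one_notin_below[OF sep] sk by (simp add: Gr_one_eq_zero_iff skewfield_def)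
  fix \<gamma> f assume "f \<in> Gr_comp \<gamma>" "f \<noteq> \<zero>\<^bsub>Gr\<^esub>"
  then obtain x where x: "x \<in> F \<gamma>" "x \<notin> below \<gamma>" "f = homog \<gamma> x"
    by (auto simp: Gr_comp_eq homog_zero_iff)
  note i = degree_inv[OF sep sk md x(1,2)] skewfieldD[OF sk F_carrier[OF x(1)] below_nonzero[OF x(2)]]
  have "f \<otimes>\<^bsub>Gr\<^esub> homog (- \<gamma>) (inv x) = \<one>\<^bsub>Gr\<^esub>" "homog (- \<gamma>) (inv x) \<otimes>\<^bsub>Gr\<^esub> f = \<one>\<^bsub>Gr\<^esub>"
    using x i by (simp_all add: homog_mult Gr_one)
  then show "f \<in> Units Gr" using x i homog_carrier by (auto simp: Units_def)
qed

lemma mult_degree_imp_valuation_ring: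
  assumes sep: "separated_filtration R F" and sk: "skewfield R" and md: mult_degree
  shows "valuation_ring_of (F 0) R"
  unfolding valuation_ring_of_def
proof (intro conjI ballI sk F0_subring)
  have conj: "u \<otimes> x \<otimes> inv u \<in> F 0" if u: "u \<in> carrier R" "u \<noteq> \<zero>" and x: "x \<in> F 0" for u x
  proof -
    obtain \<gamma> where \<gamma>: "u \<in> F \<gamma>" "u \<notin> below \<gamma>" using degree_exists[OF sep u] .
    have "u \<otimes> x \<otimes> inv u \<in> F (\<gamma> + 0 + - \<gamma>)"
      using \<gamma> x degree_inv[OF sep sk md \<gamma>] by (intro filtration_mult)
    then show ?thesis by simp
  qed
  fix u assume u: "u \<in> Units R"
  have u': "u \<in> carrier R" "u \<noteq> \<zero>" using u sk by (auto simp: skewfield_def Units_def)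
  note i = skewfieldD[OF sk u']
  show "(\<lambda>x. u \<otimes> x \<otimes> inv u) ` F 0 = F 0"
  proof
    show "(\<lambda>x. u \<otimes> x \<otimes> inv u) ` F 0 \<subseteq> F 0" using conj[OF u'] by auto
    show "F 0 \<subseteq> (\<lambda>x. u \<otimes> x \<otimes> inv u) ` F 0"
    proof
      fix x assume x: "x \<in> F 0"
      have "inv u \<otimes> x \<otimes> u \<in> F 0" using conj[OF i(2,5) x] u by simp
      moreover have "x = u \<otimes> (inv u \<otimes> x \<otimes> u) \<otimes> inv u"
      proof -
        have "u \<otimes> (inv u \<otimes> x \<otimes> u) \<otimes> inv u = (u \<otimes> inv u) \<otimes> x \<otimes> (u \<otimes> inv u)"
          using u' i(2) F_carrier[OF x] by (simp only: m_assoc m_closed)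
        then show ?thesis using i F_carrier[OF x] by simp
      qed
      ultimately show "x \<in> (\<lambda>x. u \<otimes> x \<otimes> inv u) ` F 0" by blast
    qed
  qed
next
  fix x assume "x \<in> carrier R - {\<zero>}"
  then obtain \<gamma> where \<gamma>: "x \<in> F \<gamma>" "x \<notin> below \<gamma>" using degree_exists[OF sep] by blast
  show "x \<in> F 0 \<or> inv x \<in> F 0"
  proof (cases "\<gamma> \<le> 0")
    case True then show ?thesis using \<gamma> filtration_mono by blast
  next
    case False
    then have "- \<gamma> + 0 \<le> - \<gamma> + \<gamma>" by (intro group_add_left_mono) simp
    then have "F (- \<gamma>) \<subseteq> F 0" by (intro filtration_mono) simp
    then show ?thesis using degree_inv(1)[OF sep sk md \<gamma>] by blast
  qed
qed

lemma mult_degree_imp_add_subgroup_support: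
  assumes sep: "separated_filtration R F" and sk: "skewfield R" and md: mult_degree
  shows "add_subgroup (gr_support R F)"
  unfolding add_subgroup_def
proof (intro conjI ballI)
  show "0 \<in> gr_support R F"
    using one_notin_below[OF sep] sk filtration_one by (auto simp: gr_support_iff skewfield_def)
  fix \<alpha> assume "\<alpha> \<in> gr_support R F"
  then obtain a where a: "a \<in> F \<alpha>" "a \<notin> below \<alpha>" by (auto simp: gr_support_iff)
  then show "- \<alpha> \<in> gr_support R F"
    using degree_inv[OF sep sk md] unfolding gr_support_iff by blast
  fix \<beta> assume "\<beta> \<in> gr_support R F"
  then obtain b where b: "b \<in> F \<beta>" "b \<notin> below \<beta>" by (auto simp: gr_support_iff)
  then show "\<alpha> + \<beta> \<in> gr_support R F"
    using mult_degreeD[OF md a b] filtration_mult[OF a(1) b(1)] unfolding gr_support_iff by blast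
qed

text \<open>
  An element \<open>a\<close> of degree \<open>\<gamma>\<close> in the support divides everything: \<open>c = a (a\<inverse> c)\<close>, and
  \<open>a\<inverse> c\<close> has degree at most \<open>\<delta>\<close> if \<open>c\<close> has degree at most \<open>\<gamma> + \<delta>\<close>.
\<close>

lemma mult_degree_imp_strongly_graded:
  assumes sep: "separated_filtration R F" and sk: "skewfield R" and md: mult_degree
  shows "strongly_graded (gr_support R F) Gr Gr_comp"
  unfolding strongly_graded_def
proof (intro conjI ballI)
  interpret G: ring Gr by (rule assoc_gr_ring)
  show "graded_ring (gr_support R F) Gr Gr_comp"
    using mult_degree_imp_add_subgroup_support[OF assms] by (intro assoc_gr_graded) auto
  fix \<gamma> \<delta> assume "\<gamma> \<in> gr_support R F"
  then obtain a where a: "a \<in> F \<gamma>" "a \<notin> below \<gamma>" by (auto simp: gr_support_iff)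
  note i = degree_inv[OF sep sk md a] skewfieldD[OF sk F_carrier[OF a(1)] below_nonzero[OF a(2)]]
  let ?P = "{x \<otimes>\<^bsub>Gr\<^esub> y |x y. x \<in> Gr_comp \<gamma> \<and> y \<in> Gr_comp \<delta>}"
  have sub: "?P \<subseteq> Gr_comp (\<gamma> + \<delta>)"
    by (auto simp: Gr_comp_eq homog_mult filtration_mult)
  have "Gr_comp (\<gamma> + \<delta>) \<subseteq> ?P"
  proof
    fix f assume "f \<in> Gr_comp (\<gamma> + \<delta>)"
    then obtain c where c: "c \<in> F (\<gamma> + \<delta>)" "f = homog (\<gamma> + \<delta>) c" by (auto simp: Gr_comp_eq)
    have "inv a \<otimes> c \<in> F (- \<gamma> + (\<gamma> + \<delta>))" using i(1) c(1) by (rule filtration_mult)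
    then have d: "inv a \<otimes> c \<in> F \<delta>" by simp
    have "a \<otimes> (inv a \<otimes> c) = c" using a c i by (simp add: m_assoc[symmetric] F_carrier)
    then have "f = homog \<gamma> a \<otimes>\<^bsub>Gr\<^esub> homog \<delta> (inv a \<otimes> c)" using c(2) a(1) d by (simp add: homog_mult)
    then show "f \<in> ?P" using a(1) d by (auto simp: Gr_comp_eq)
  qed
  then have "Gr_comp (\<gamma> + \<delta>) \<subseteq> generate (add_monoid Gr) ?P" by (auto intro: generate.incl)
  moreover have "generate (add_monoid Gr) ?P \<subseteq> Gr_comp (\<gamma> + \<delta>)"
    using sub additive_subgroup.a_subgroup[OF Gr_comp_additive_subgroup]
    by (rule G.add.generate_subgroup_incl)
  ultimately show "generate (add_monoid Gr) ?P = Gr_comp (\<gamma> + \<delta>)" by simp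
qed

section \<open>Valuation rings and strong gradings\<close>

lemma F0_ring: "ring (R\<lparr>carrier := F 0\<rparr>)"
  by (rule subring_is_ring[OF F0_subring])

lemma mult_degree_imp_unique_maximalideal:
  assumes sep: "separated_filtration R F" and sk: "skewfield R" and md: mult_degree
  shows "unique_maximalideal (below 0) (R\<lparr>carrier := F 0\<rparr>)"
proof (rule ring.nonunit_ideal_unique_maximal[OF F0_ring])
  show "ideal (below 0) (R\<lparr>carrier := F 0\<rparr>)"
  proof (rule idealI[OF F0_ring])
    show "subgroup (below 0) (add_monoid (R\<lparr>carrier := F 0\<rparr>))"
      using add.subgroup_incl[OF Bsub.a_subgroup Fsub.a_subgroup below_subset] by simp
  qed (use F_mult_below[of _ 0 _ 0] below_mult_F[of _ 0 _ 0] in auto)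
  show "\<one>\<^bsub>R\<lparr>carrier := F 0\<rparr>\<^esub> \<notin> below 0"
    using one_notin_below[OF sep] sk by (simp add: skewfield_def)
  fix x assume "x \<in> carrier (R\<lparr>carrier := F 0\<rparr>) - below 0"
  then have x: "x \<in> F 0" "x \<notin> below 0" by auto
  then show "\<exists>y\<in>carrier (R\<lparr>carrier := F 0\<rparr>). y \<otimes>\<^bsub>R\<lparr>carrier := F 0\<rparr>\<^esub> x = \<one>\<^bsub>R\<lparr>carrier := F 0\<rparr>\<^esub>"
    using degree_inv(1)[OF sep sk md x] skewfieldD(3)[OF sk F_carrier below_nonzero]
    by (auto intro!: bexI[of _ "inv x"])
qed

text \<open>
  The nonunits of the valuation ring \<open>F 0\<close> form a maximal ideal, so they are the
  elements of \<open>below 0\<close>: the elements of degree \<open>0\<close> are units of \<open>F 0\<close>. Strong gradedness moves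
  this to any degree \<open>\<alpha>\<close> of the support. As \<open>1\<close> is a sum of products from degrees \<open>- \<alpha>\<close> and \<open>\<alpha>\<close>,
  one of these products is a unit of \<open>F 0\<close>, so some \<open>y\<close> of degree \<open>\<alpha>\<close> has its inverse \<open>z\<close> in
  \<open>F (- \<alpha>)\<close>. For \<open>a\<close> of degree \<open>\<alpha>\<close> the element \<open>z a\<close> then has degree \<open>0\<close> and is a unit of
  \<open>F 0\<close>, so the inverse of \<open>a\<close> lies in \<open>F (- \<alpha>)\<close>. Multiplying \<open>a b\<close> by it shows that
  \<open>a b\<close> cannot have smaller degree than \<open>\<alpha> + \<beta>\<close>.
\<close>

lemma strongly_graded_imp_mult_degree:
  assumes sep: "separated_filtration R F" and sk: "skewfield R"
    and val: "valuation_ring_of (F 0) R"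
    and max: "unique_maximalideal (below 0) (R\<lparr>carrier := F 0\<rparr>)"
    and S: "add_subgroup (gr_support R F)"
    and strong: "strongly_graded (gr_support R F) Gr Gr_comp"
  shows mult_degree
  unfolding mult_degree_def
proof (intro allI impI notI)
  interpret G: ring Gr by (rule assoc_gr_ring)
  have one: "\<one> \<notin> below 0" using one_notin_below[OF sep] sk by (simp add: skewfield_def)
  have inv0: "inv x \<in> F 0" if x: "x \<in> F 0" "x \<notin> below 0" for x
  proof (rule ccontr)
    assume "inv x \<notin> F 0"
    have "x \<in> {x \<in> F 0. \<forall>y\<in>F 0. y \<otimes> x \<noteq> \<one>}"
    proof (clarsimp simp: x)
      fix y assume y: "y \<in> F 0" "y \<otimes> x = \<one>"
      then have "y = inv x"
        using skewfield_mult_one_commute[OF sk, of y x] x by (intro inv_char[symmetric]) auto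
      then show False using y \<open>inv x \<notin> F 0\<close> by simp
    qed
    moreover have "{x \<in> F 0. \<forall>y\<in>F 0. y \<otimes> x \<noteq> \<one>} = below 0"
      using valuation_ring_unique_maximalideal[OF val] max
      unfolding unique_maximalideal_def by blast
    ultimately show False using x by blast
  qed
  fix \<alpha> \<beta> a b
  assume a: "a \<in> F \<alpha> - below \<alpha>" and b: "b \<in> F \<beta> - below \<beta>" and ab: "a \<otimes> b \<in> below (\<alpha> + \<beta>)"
  have \<alpha>: "\<alpha> \<in> gr_support R F" using a by (auto simp: gr_support_iff)
  then have \<alpha>': "- \<alpha> \<in> gr_support R F" using S by (simp add: add_subgroup_def)
  have "\<exists>f\<in>Gr_comp (- \<alpha>). \<exists>g\<in>Gr_comp \<alpha>. f \<otimes>\<^bsub>Gr\<^esub> g \<noteq> \<zero>\<^bsub>Gr\<^esub>"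
  proof (rule ccontr)
    let ?P = "{f \<otimes>\<^bsub>Gr\<^esub> g |f g. f \<in> Gr_comp (- \<alpha>) \<and> g \<in> Gr_comp \<alpha>}"
    assume "\<not> ?thesis"
    then have "?P \<subseteq> {\<zero>\<^bsub>Gr\<^esub>}" by blast
    then have "generate (add_monoid Gr) ?P \<subseteq> {\<zero>\<^bsub>Gr\<^esub>}"
      using G.add.generate_subgroup_incl[OF _ G.add.triv_subgroup] by simp
    moreover have "generate (add_monoid Gr) ?P = Gr_comp (- \<alpha> + \<alpha>)"
      using strong \<alpha> \<alpha>' unfolding strongly_graded_def by blast
    moreover have "\<one>\<^bsub>Gr\<^esub> \<in> Gr_comp 0" unfolding Gr_one Gr_comp_eq using filtration_one by blast
    ultimately show False using one Gr_one_eq_zero_iff by auto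
  qed
  then obtain x y where xy: "x \<in> F (- \<alpha>)" "y \<in> F \<alpha>" "homog (- \<alpha>) x \<otimes>\<^bsub>Gr\<^esub> homog \<alpha> y \<noteq> \<zero>\<^bsub>Gr\<^esub>"
    by (auto simp: Gr_comp_eq)
  have prod: "x \<otimes> y \<in> F 0" "x \<otimes> y \<notin> below 0"
    using xy filtration_mult[OF xy(1,2)] homog_mult[OF xy(1,2)] homog_zero_iff[of "x \<otimes> y" 0]
    by auto
  have car: "a \<in> carrier R" "b \<in> carrier R" "x \<in> carrier R" "y \<in> carrier R"
    using a b xy by auto
  define z where "z = inv (x \<otimes> y) \<otimes> x"
  have z: "z \<in> F (- \<alpha>)"
    using filtration_mult[OF inv0[OF prod] xy(1)] by (simp add: z_def)
  have inv_prod: "inv (x \<otimes> y) \<in> carrier R" "inv (x \<otimes> y) \<otimes> (x \<otimes> y) = \<one>"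
    using skewfieldD[OF sk _ below_nonzero[OF prod(2)]] car by auto
  have zy: "z \<otimes> y = \<one>" using inv_prod car by (simp add: z_def m_assoc)
  then have yz: "y \<otimes> z = \<one>" using skewfield_mult_one_commute[OF sk, of z y] car z by auto
  have a_eq: "a = y \<otimes> (z \<otimes> a)" using yz car z by (simp add: m_assoc[symmetric] F_carrier)
  \<comment> \<open>\<open>inv (z \<otimes> a) \<otimes> z\<close> is the inverse of \<open>a\<close>, in the form that shows its degree\<close>
  have za: "z \<otimes> a \<in> F 0" using filtration_mult[OF z, of a \<alpha>] a by simp
  moreover have za': "z \<otimes> a \<notin> below 0"
  proof
    assume "z \<otimes> a \<in> below 0"
    then have "a \<in> below (\<alpha> + 0)" using F_mult_below[OF xy(2)] a_eq by metis
    then show False using a by simp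
  qed
  ultimately have w: "inv (z \<otimes> a) \<in> F 0" by (rule inv0)
  have w_inv: "inv (z \<otimes> a) \<otimes> (z \<otimes> a) = \<one>"
    using skewfieldD(3)[OF sk _ below_nonzero[OF za']] za by auto
  have "inv (z \<otimes> a) \<otimes> z \<in> F (0 + - \<alpha>)" using w z by (rule filtration_mult)
  then have "inv (z \<otimes> a) \<otimes> z \<otimes> (a \<otimes> b) \<in> below (- \<alpha> + (\<alpha> + \<beta>))"
    using F_mult_below[OF _ ab, of "inv (z \<otimes> a) \<otimes> z" "- \<alpha>"] by simp
  moreover have "inv (z \<otimes> a) \<otimes> z \<otimes> (a \<otimes> b) = inv (z \<otimes> a) \<otimes> (z \<otimes> a) \<otimes> b"
    using w z car by (simp add: m_assoc F_carrier)
  ultimately show False using w_inv b car by simp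
qed

end

theorem proposition1p2:
  fixes R :: "('a, 'm) ring_scheme"
    and F :: "'g::linordered_group_add \<Rightarrow> 'a set"
  assumes "artinian_ring R"
    and "ring_filtration R F"
    and "separated_filtration R F"
  shows "(nc_domain (assoc_gr R F) \<longleftrightarrow>
            skewfield R \<and> gr_skewfield UNIV (assoc_gr R F) (assoc_gr_component R F)) \<and>
         (skewfield R \<and> gr_skewfield UNIV (assoc_gr R F) (assoc_gr_component R F) \<longleftrightarrow>
            skewfield R \<and>
            valuation_ring_of (F 0) R \<and>
            unique_maximalideal (filt_below R F 0) (R\<lparr>carrier := F 0\<rparr>) \<and>
            add_subgroup (gr_support R F) \<and>
            strongly_graded (gr_support R F) (assoc_gr R F) (assoc_gr_component R F))"
proof -
  interpret ring_filtration R F by fact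
  note sep = assms(3)
  have i: "nc_domain (assoc_gr R F) \<longleftrightarrow> skewfield R \<and> mult_degree"
  proof
    assume dom: "nc_domain (assoc_gr R F)"
    then have md: mult_degree by (rule nc_domain_Gr_imp_mult_degree)
    have "\<one>\<^bsub>R\<^esub> \<notin> filt_below R F 0"
      using dom Gr_one_eq_zero_iff by (simp add: nc_domain_def)
    then have "nc_domain R" by (intro mult_degree_imp_nc_domain sep md below_nonzero)
    then have "skewfield R"
      using assms(1) by (intro left_artinian_domain_imp_skewfield) (auto simp: artinian_ring_def)
    then show "skewfield R \<and> mult_degree" using md by simp
  next
    assume "skewfield R \<and> mult_degree"
    then show "nc_domain (assoc_gr R F)"
      using mult_degree_imp_nc_domain_Gr one_notin_below[OF sep] by (simp add: skewfield_def)
  qed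
  have ii: "skewfield R \<and> gr_skewfield UNIV (assoc_gr R F) (assoc_gr_component R F) \<longleftrightarrow>
      skewfield R \<and> mult_degree"
    using gr_skewfield_imp_mult_degree mult_degree_imp_gr_skewfield[OF sep] by blast
  have iii: "skewfield R \<and> valuation_ring_of (F 0) R \<and>
      unique_maximalideal (filt_below R F 0) (R\<lparr>carrier := F 0\<rparr>) \<and>
      add_subgroup (gr_support R F) \<and>
      strongly_graded (gr_support R F) (assoc_gr R F) (assoc_gr_component R F) \<longleftrightarrow>
      skewfield R \<and> mult_degree"
    using strongly_graded_imp_mult_degree[OF sep] mult_degree_imp_valuation_ring[OF sep]
      mult_degree_imp_unique_maximalideal[OF sep] mult_degree_imp_add_subgroup_support[OF sep]
      mult_degree_imp_strongly_graded[OF sep] by blast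
  show ?thesis unfolding i ii iii by simp
qed

end
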